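(* Let $V$ be a pseudo-Euclidean vector space of even dimension, let $\varepsilon\in\{-1,+1\}$ and let $J\in\mathfrak{so}(V)$ with $J^2=\varepsilon\,\mathrm{Id}$. Let $\eta\in\Lambda^3V$ be a non-zero element with isotropic support which satisfies $\eta_XJ+J\eta_X=0$ for all $X\in V$ (i.e. $\eta$ has type $(3,0)+(0,3)$) and which has rational coefficients with respect to some basis of $V$. Then $\mathcal{L}(\eta)$ admits a lattice $\Gamma$, and the quotient $M=\Gamma\setminus\mathcal{L}(\eta)$, with the structure $(h,J)$ induced from the left-invariant structure $(h,J)$ on $\mathcal{L}(\eta)$, is a compact inhomogeneous nearly Kähler manifold if $\varepsilon=-1$, and a compact inhomogeneous nearly para-Kähler manifold if $\varepsilon=+1$; that is, $(M,h,J)$ does not admit any transitive group of automorphisms of the nearly (para-)Kähler structure.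
   Context: For a pseudo-Euclidean vector space $(V,\langle\cdot,\cdot\rangle)$, identify $V\cong V^*$ and regard $\eta\in\Lambda^3V$ as an alternating trilinear form; $\eta_X\in\mathfrak{so}(V)$ is defined by $\langle\eta_XY,Z\rangle=\eta(X,Y,Z)$. The support of $\eta$ is $\Sigma_\eta:=\mathrm{span}\{\eta_XY\mid X,Y\in V\}$. When $\Sigma_\eta$ is totally isotropic, $\mathcal{L}(\eta):=\{g_X\mid X\in V\}$ is the 2-step nilpotent group of affine isometries $g_X(x)=(\mathbb{1}+\eta_X)x+X$ of $V$; it acts simply transitively on $V$, and $h$ is the flat bi-invariant metric on $\mathcal{L}(\eta)$ obtained by pulling back the scalar product by the orbit map $g\mapsto g0$. Its Lie algebra is identified with $V$ with bracket $[X,Y]=2\eta_XY$, and $J\in\mathfrak{so}(V)$ thereby defines a left-invariant endomorphism field $J$ on $\mathcal{L}(\eta)$, which descends to $\Gamma\setminus\mathcal{L}(\eta)$. A lattice is a discrete co-compact subgroup. A nearly Kähler (respectively nearly para-Kähler) manifold is a pseudo-Riemannian manifold $(M,g)$ with a $g$-skew-symmetric endomorphism field $J$ with $J^2=-\mathrm{Id}$ (respectively $J^2=\mathrm{Id}$) such that the Levi-Civita connection $D$ satisfies $(D_XJ)X=0$ for all $X\in TM$. Automorphisms are isometries preserving $J$. *)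

theory Defs
  imports "HOL-Analysis.Analysis" "HOL-Algebra.Coset" "HOL-Algebra.Bij"
begin

section \<open>Smooth manifolds and tensor fields\<close>

text \<open>
  For an open set \<open>S\<close> of a Euclidean space: \<open>f\<close> is \<open>C\<^sup>k\<close> iff all its iterated directional
  derivatives of order at most \<open>k\<close> exist and are continuous.
\<close>

primrec Ck_on :: "nat \<Rightarrow> 'v::euclidean_space set \<Rightarrow> ('v \<Rightarrow> 'b::real_normed_vector) \<Rightarrow> bool" where
  "Ck_on 0 S f \<longleftrightarrow> continuous_on S f"
| "Ck_on (Suc k) S f \<longleftrightarrow>
     (\<forall>x\<in>S. f differentiable (at x)) \<and>
     (\<forall>v. Ck_on k S (\<lambda>x. frechet_derivative f (at x) v))"

definition smooth_on :: "'v::euclidean_space set \<Rightarrow> ('v \<Rightarrow> 'b::real_normed_vector) \<Rightarrow> bool" where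
  "smooth_on S f \<longleftrightarrow> (\<forall>k. Ck_on k S f)"

text \<open>
  A chart is a pair of a domain and a coordinate map (whose values off the domain are irrelevant).
  \<open>chart_expr c d f\<close> is the expression of a map \<open>f\<close> in the charts \<open>c\<close> and \<open>d\<close>, to be used
  on the coordinate set \<open>chart_dom c d f\<close>.
\<close>

type_synonym ('m, 'v) chart = "'m set \<times> ('m \<Rightarrow> 'v)"

definition chart_expr ::
  "('m, 'v) chart \<Rightarrow> ('n, 'w) chart \<Rightarrow> ('m \<Rightarrow> 'n) \<Rightarrow> 'v \<Rightarrow> 'w" where
  "chart_expr c d f = snd d \<circ> f \<circ> inv_into (fst c) (snd c)"

definition chart_dom ::
  "('m, 'v) chart \<Rightarrow> ('n, 'w) chart \<Rightarrow> ('m \<Rightarrow> 'n) \<Rightarrow> 'v set" where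
  "chart_dom c d f = snd c ` (fst c \<inter> f -` fst d)"

definition chart_diff ::
  "('m, 'v::euclidean_space) chart \<Rightarrow> ('n, 'w::euclidean_space) chart \<Rightarrow> ('m \<Rightarrow> 'n) \<Rightarrow> 'v \<Rightarrow> 'v \<Rightarrow> 'w"
  where "chart_diff c d f x = frechet_derivative (chart_expr c d f) (at x)"

definition smooth_manifold ::
  "'m topology \<Rightarrow> ('m, 'v::euclidean_space) chart set \<Rightarrow> bool" where
  "smooth_manifold X A \<longleftrightarrow>
     Hausdorff_space X \<and>
     (\<exists>\<B>. countable \<B> \<and> (\<forall>U\<in>\<B>. openin X U) \<and>
          (\<forall>U p. openin X U \<and> p \<in> U \<longrightarrow> (\<exists>V\<in>\<B>. p \<in> V \<and> V \<subseteq> U))) \<and>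
     \<Union> (fst ` A) = topspace X \<and>
     (\<forall>(U, \<phi>)\<in>A. openin X U \<and> open (\<phi> ` U) \<and>
          homeomorphic_map (subtopology X U) (top_of_set (\<phi> ` U)) \<phi>) \<and>
     (\<forall>c\<in>A. \<forall>d\<in>A. smooth_on (chart_dom c d id) (chart_expr c d id))"

definition smooth_map ::
  "'m topology \<Rightarrow> ('m, 'v::euclidean_space) chart set \<Rightarrow>
   'n topology \<Rightarrow> ('n, 'w::euclidean_space) chart set \<Rightarrow> ('m \<Rightarrow> 'n) \<Rightarrow> bool" where
  "smooth_map X A Y A' f \<longleftrightarrow>
     continuous_map X Y f \<and>
     (\<forall>c\<in>A. \<forall>d\<in>A'. smooth_on (chart_dom c d f) (chart_expr c d f))"

text \<open>
  Tensor fields are given by their components in the charts of an atlas: \<open>g c x u v\<close> is the value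
  of the metric at the point with \<open>c\<close>-coordinate \<open>x\<close> on the tangent vectors with
  \<open>c\<close>-components \<open>u\<close>, \<open>v\<close>, and \<open>J c x u\<close> is the vector of \<open>c\<close>-components of the image of
  \<open>u\<close> under the endomorphism at that point. Off the coordinate set of \<open>c\<close> the values are
  irrelevant. The tensorial transformation law says that the identity map, read in any two charts,
  preserves the field.
\<close>

type_synonym ('m, 'v) metric_field = "('m, 'v) chart \<Rightarrow> 'v \<Rightarrow> 'v \<Rightarrow> 'v \<Rightarrow> real"
type_synonym ('m, 'v) endo_field = "('m, 'v) chart \<Rightarrow> 'v \<Rightarrow> 'v \<Rightarrow> 'v"

text \<open>\<open>g = f\<^sup>* g'\<close>:\<close>

definition preserves_metric ::
  "('m, 'v::euclidean_space) chart set \<Rightarrow> ('m, 'v) metric_field \<Rightarrow>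
   ('n, 'w::euclidean_space) chart set \<Rightarrow> ('n, 'w) metric_field \<Rightarrow> ('m \<Rightarrow> 'n) \<Rightarrow> bool" where
  "preserves_metric A g A' g' f \<longleftrightarrow>
     (\<forall>c\<in>A. \<forall>d\<in>A'. \<forall>x\<in>chart_dom c d f. \<forall>u v.
        g' d (chart_expr c d f x) (chart_diff c d f x u) (chart_diff c d f x v) = g c x u v)"

text \<open>\<open>df \<circ> J = J' \<circ> df\<close>:\<close>

definition preserves_endo ::
  "('m, 'v::euclidean_space) chart set \<Rightarrow> ('m, 'v) endo_field \<Rightarrow>
   ('n, 'w::euclidean_space) chart set \<Rightarrow> ('n, 'w) endo_field \<Rightarrow> ('m \<Rightarrow> 'n) \<Rightarrow> bool" where
  "preserves_endo A J A' J' f \<longleftrightarrow>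
     (\<forall>c\<in>A. \<forall>d\<in>A'. \<forall>x\<in>chart_dom c d f. \<forall>u.
        J' d (chart_expr c d f x) (chart_diff c d f x u) = chart_diff c d f x (J c x u))"

text \<open>A pseudo-Euclidean scalar product, of arbitrary signature.\<close>

definition scalar_product :: "('v::real_vector \<Rightarrow> 'v \<Rightarrow> real) \<Rightarrow> bool" where
  "scalar_product B \<longleftrightarrow>
     bilinear B \<and> (\<forall>u v. B u v = B v u) \<and> (\<forall>u. (\<forall>v. B u v = 0) \<longrightarrow> u = 0)"

definition pseudo_riemannian ::
  "('m, 'v::euclidean_space) chart set \<Rightarrow> ('m, 'v) metric_field \<Rightarrow> bool" where
  "pseudo_riemannian A g \<longleftrightarrow>
     (\<forall>c\<in>A. (\<forall>x \<in> snd c ` fst c. scalar_product (g c x)) \<and>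
             (\<forall>u v. smooth_on (snd c ` fst c) (\<lambda>x. g c x u v))) \<and>
     preserves_metric A g A g id"

definition endomorphism_field ::
  "('m, 'v::euclidean_space) chart set \<Rightarrow> ('m, 'v) endo_field \<Rightarrow> bool" where
  "endomorphism_field A J \<longleftrightarrow>
     (\<forall>c\<in>A. (\<forall>x \<in> snd c ` fst c. linear (J c x)) \<and>
             (\<forall>u. smooth_on (snd c ` fst c) (\<lambda>x. J c x u))) \<and>
     preserves_endo A J A J id"

text \<open>
  \<open>\<Gamma>\<close> is the family of Christoffel symbols, on an open set \<open>S\<close> of the coordinate space, of the
  Levi-Civita connection of the metric \<open>g\<close>: the torsion-free metric connection
  \<open>D\<^sub>u Y = \<partial>\<^sub>u Y + \<Gamma>(u, Y)\<close>.
\<close>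

definition levi_civita ::
  "'v::euclidean_space set \<Rightarrow> ('v \<Rightarrow> 'v \<Rightarrow> 'v \<Rightarrow> real) \<Rightarrow> ('v \<Rightarrow> 'v \<Rightarrow> 'v \<Rightarrow> 'v) \<Rightarrow> bool" where
  "levi_civita S g \<Gamma> \<longleftrightarrow>
     (\<forall>x\<in>S. bilinear (\<Gamma> x)) \<and>
     (\<forall>u v. smooth_on S (\<lambda>x. \<Gamma> x u v)) \<and>
     (\<forall>x\<in>S. \<forall>u v. \<Gamma> x u v = \<Gamma> x v u) \<and>
     (\<forall>x\<in>S. \<forall>u v w. frechet_derivative (\<lambda>y. g y v w) (at x) u
                        = g x (\<Gamma> x u v) w + g x v (\<Gamma> x u w))"

text \<open>\<open>D\<^sub>u Y\<close> at \<open>x\<close>, and \<open>(D\<^sub>u J) v = D\<^sub>u (J v) - J (D\<^sub>u v)\<close> with \<open>v\<close> extended constantly:\<close>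

definition cov_deriv ::
  "('v::euclidean_space \<Rightarrow> 'v \<Rightarrow> 'v \<Rightarrow> 'v) \<Rightarrow> 'v \<Rightarrow> 'v \<Rightarrow> ('v \<Rightarrow> 'v) \<Rightarrow> 'v" where
  "cov_deriv \<Gamma> x u Y = frechet_derivative Y (at x) u + \<Gamma> x u (Y x)"

definition cov_deriv_endo ::
  "('v::euclidean_space \<Rightarrow> 'v \<Rightarrow> 'v \<Rightarrow> 'v) \<Rightarrow> ('v \<Rightarrow> 'v \<Rightarrow> 'v) \<Rightarrow> 'v \<Rightarrow> 'v \<Rightarrow> 'v \<Rightarrow> 'v" where
  "cov_deriv_endo \<Gamma> J x u v =
     cov_deriv \<Gamma> x u (\<lambda>y. J y v) - J x (cov_deriv \<Gamma> x u (\<lambda>y. v))"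

text \<open>
  Nearly Kaehler for \<open>\<epsilon> = -1\<close>, nearly para-Kaehler for \<open>\<epsilon> = 1\<close>. By the fundamental theorem of
  pseudo-Riemannian geometry the \<open>\<Gamma>\<close> below exists and is unique on every chart, so that the
  existential quantifier merely names the Levi-Civita connection.
\<close>

definition nearly_kaehler ::
  "real \<Rightarrow> 'm topology \<Rightarrow> ('m, 'v::euclidean_space) chart set \<Rightarrow>
   ('m, 'v) metric_field \<Rightarrow> ('m, 'v) endo_field \<Rightarrow> bool" where
  "nearly_kaehler \<epsilon> X A g J \<longleftrightarrow>
     smooth_manifold X A \<and> pseudo_riemannian A g \<and> endomorphism_field A J \<and>
     (\<forall>c\<in>A. \<forall>x \<in> snd c ` fst c. \<forall>u v.
        g c x (J c x u) v = - g c x u (J c x v) \<and> J c x (J c x u) = \<epsilon> *\<^sub>R u) \<and>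
     (\<forall>c\<in>A. \<exists>\<Gamma>. levi_civita (snd c ` fst c) (g c) \<Gamma> \<and>
        (\<forall>x \<in> snd c ` fst c. \<forall>u. cov_deriv_endo \<Gamma> (J c) x u u = 0))"

definition automorphism ::
  "'m topology \<Rightarrow> ('m, 'v::euclidean_space) chart set \<Rightarrow>
   ('m, 'v) metric_field \<Rightarrow> ('m, 'v) endo_field \<Rightarrow> ('m \<Rightarrow> 'm) \<Rightarrow> bool" where
  "automorphism X A g J f \<longleftrightarrow>
     bij_betw f (topspace X) (topspace X) \<and>
     smooth_map X A X A f \<and> smooth_map X A X A (inv_into (topspace X) f) \<and>
     preserves_metric A g A g f \<and> preserves_endo A J A J f"

definition admits_transitive_automorphism_group ::
  "'m topology \<Rightarrow> ('m, 'v::euclidean_space) chart set \<Rightarrow>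
   ('m, 'v) metric_field \<Rightarrow> ('m, 'v) endo_field \<Rightarrow> bool" where
  "admits_transitive_automorphism_group X A g J \<longleftrightarrow>
     (\<exists>G. subgroup G (BijGroup (topspace X)) \<and> (\<forall>f\<in>G. automorphism X A g J f) \<and>
          (\<forall>p\<in>topspace X. \<forall>q\<in>topspace X. \<exists>f\<in>G. f p = q))"

section \<open>Quotients\<close>

definition quot_topology :: "'a topology \<Rightarrow> ('a \<Rightarrow> 'b) \<Rightarrow> 'b topology" where
  "quot_topology X f =
     topology (\<lambda>U. U \<subseteq> f ` topspace X \<and> openin X {x \<in> topspace X. f x \<in> U})"

lemma openin_quot_topology:
  "openin (quot_topology X f) U \<longleftrightarrow> U \<subseteq> f ` topspace X \<and> openin X {x \<in> topspace X. f x \<in> U}"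
proof -
  have "istopology (\<lambda>U. U \<subseteq> f ` topspace X \<and> openin X {x \<in> topspace X. f x \<in> U})"
    unfolding istopology_def
  proof (intro conjI allI impI)
    fix S T assume "S \<subseteq> f ` topspace X \<and> openin X {x \<in> topspace X. f x \<in> S}"
      and "T \<subseteq> f ` topspace X \<and> openin X {x \<in> topspace X. f x \<in> T}"
    moreover have "{x \<in> topspace X. f x \<in> S \<inter> T} =
        {x \<in> topspace X. f x \<in> S} \<inter> {x \<in> topspace X. f x \<in> T}" by blast
    ultimately show "S \<inter> T \<subseteq> f ` topspace X" "openin X {x \<in> topspace X. f x \<in> S \<inter> T}"
      by auto
  next
    fix \<K> assume *: "\<forall>K\<in>\<K>. K \<subseteq> f ` topspace X \<and> openin X {x \<in> topspace X. f x \<in> K}"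
    then show "\<Union>\<K> \<subseteq> f ` topspace X" by blast
    have "{x \<in> topspace X. f x \<in> \<Union>\<K>} = (\<Union>K\<in>\<K>. {x \<in> topspace X. f x \<in> K})" by blast
    with * show "openin X {x \<in> topspace X. f x \<in> \<Union>\<K>}" by auto
  qed
  then show ?thesis
    by (simp add: quot_topology_def)
qed

lemma topspace_quot_topology: "topspace (quot_topology X f) = f ` topspace X"
proof
  show "topspace (quot_topology X f) \<subseteq> f ` topspace X"
    by (meson openin_quot_topology openin_topspace)
  have "{x \<in> topspace X. f x \<in> f ` topspace X} = topspace X" by blast
  then have "openin (quot_topology X f) (f ` topspace X)"
    by (simp add: openin_quot_topology)
  then show "f ` topspace X \<subseteq> topspace (quot_topology X f)"
    by (rule openin_subset)
qed

lemma quotient_map_quot_topology: "quotient_map X (quot_topology X f) f"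
  unfolding quotient_map_def by (auto simp: topspace_quot_topology openin_quot_topology)

text \<open>The charts of the quotient are the charts upstairs composed with local sections of \<open>p\<close>.\<close>

definition quot_atlas ::
  "'a topology \<Rightarrow> ('a, 'v) chart set \<Rightarrow> ('a \<Rightarrow> 'b) \<Rightarrow> ('b, 'v) chart set" where
  "quot_atlas X A p =
     {(p ` W, \<phi> \<circ> inv_into W p) | U \<phi> W. (U, \<phi>) \<in> A \<and> openin X W \<and> W \<subseteq> U \<and> inj_on p W}"

section \<open>The group defined by a three-form\<close>

definition alternating3 :: "('v::real_vector \<Rightarrow> 'v \<Rightarrow> 'v \<Rightarrow> real) \<Rightarrow> bool" where
  "alternating3 \<eta> \<longleftrightarrow>
     (\<forall>y z. linear (\<lambda>x. \<eta> x y z)) \<and> (\<forall>x z. linear (\<lambda>y. \<eta> x y z)) \<and>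
     (\<forall>x y. linear (\<lambda>z. \<eta> x y z)) \<and>
     (\<forall>x y. \<eta> x x y = 0 \<and> \<eta> x y x = 0 \<and> \<eta> y x x = 0)"

definition so_pred :: "('v::real_vector \<Rightarrow> 'v \<Rightarrow> real) \<Rightarrow> ('v \<Rightarrow> 'v) \<Rightarrow> bool" where
  "so_pred B J \<longleftrightarrow> linear J \<and> (\<forall>u v. B (J u) v = - B u (J v))"

text \<open>\<open>contr B \<eta> X Y\<close> is \<open>\<eta>\<^sub>X Y\<close>.\<close>

definition contr ::
  "('v::real_vector \<Rightarrow> 'v \<Rightarrow> real) \<Rightarrow> ('v \<Rightarrow> 'v \<Rightarrow> 'v \<Rightarrow> real) \<Rightarrow> 'v \<Rightarrow> 'v \<Rightarrow> 'v" where
  "contr B \<eta> X Y = (THE W. \<forall>Z. B W Z = \<eta> X Y Z)"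

definition supp3 ::
  "('v::real_vector \<Rightarrow> 'v \<Rightarrow> real) \<Rightarrow> ('v \<Rightarrow> 'v \<Rightarrow> 'v \<Rightarrow> real) \<Rightarrow> 'v set" where
  "supp3 B \<eta> = span {contr B \<eta> X Y | X Y. True}"

definition totally_isotropic :: "('v \<Rightarrow> 'v \<Rightarrow> real) \<Rightarrow> 'v set \<Rightarrow> bool" where
  "totally_isotropic B S \<longleftrightarrow> (\<forall>u\<in>S. \<forall>v\<in>S. B u v = 0)"

text \<open>
  The coefficients of \<open>\<eta>\<close>, as a trilinear form, in the basis \<open>E\<close>. Its coefficients as a
  trivector in \<open>E\<close> are its coefficients as a form in the metrically dual basis of \<open>E\<close>, so that
  for the existence of a basis with rational coefficients the two readings agree.
\<close>

definition rational_coefficients ::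
  "('v::real_vector \<Rightarrow> 'v \<Rightarrow> 'v \<Rightarrow> real) \<Rightarrow> 'v set \<Rightarrow> bool" where
  "rational_coefficients \<eta> E \<longleftrightarrow> (\<forall>x\<in>E. \<forall>y\<in>E. \<forall>z\<in>E. \<eta> x y z \<in> \<rat>)"

definition gtrans ::
  "('v::real_vector \<Rightarrow> 'v \<Rightarrow> real) \<Rightarrow> ('v \<Rightarrow> 'v \<Rightarrow> 'v \<Rightarrow> real) \<Rightarrow> 'v \<Rightarrow> 'v \<Rightarrow> 'v" where
  "gtrans B \<eta> X = (\<lambda>x. x + contr B \<eta> X x + X)"

definition Lgroup ::
  "('v::real_vector \<Rightarrow> 'v \<Rightarrow> real) \<Rightarrow> ('v \<Rightarrow> 'v \<Rightarrow> 'v \<Rightarrow> real) \<Rightarrow> ('v \<Rightarrow> 'v) monoid" where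
  "Lgroup B \<eta> = \<lparr>carrier = range (gtrans B \<eta>), mult = (\<lambda>f g. f \<circ> g), one = id\<rparr>"

text \<open>
  On a finite-dimensional space the topology of pointwise convergence (which is the topology of
  the type \<open>'v \<Rightarrow> 'v\<close>) induces the usual topology on the affine group and its subgroups.
\<close>

definition Ltop ::
  "('v::euclidean_space \<Rightarrow> 'v \<Rightarrow> real) \<Rightarrow> ('v \<Rightarrow> 'v \<Rightarrow> 'v \<Rightarrow> real) \<Rightarrow> ('v \<Rightarrow> 'v) topology" where
  "Ltop B \<eta> = top_of_set (carrier (Lgroup B \<eta>))"

text \<open>The orbit map \<open>g \<mapsto> g 0\<close> as a global chart; the inverse of this chart is \<open>X \<mapsto> g\<^sub>X\<close>.\<close>

definition orbit_chart ::
  "('v::euclidean_space \<Rightarrow> 'v \<Rightarrow> real) \<Rightarrow> ('v \<Rightarrow> 'v \<Rightarrow> 'v \<Rightarrow> real) \<Rightarrow> ('v \<Rightarrow> 'v, 'v) chart" where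
  "orbit_chart B \<eta> = (carrier (Lgroup B \<eta>), \<lambda>g. g 0)"

text \<open>The pull-back of the scalar product by the orbit map has constant components in this chart:\<close>

definition Lmetric :: "('v \<Rightarrow> 'v \<Rightarrow> real) \<Rightarrow> ('v \<Rightarrow> 'v, 'v) metric_field" where
  "Lmetric B = (\<lambda>c x. B)"

text \<open>
  The differential at the identity of the left translation by \<open>g\<^sub>X\<close>, in the orbit chart, in which
  the identity has coordinate \<open>0\<close> and \<open>g\<^sub>X\<close> has coordinate \<open>X\<close>. The Lie algebra is identified
  with \<open>V\<close> by the orbit chart; \<open>J\<close> is transported from the identity by left translations.
\<close>

definition left_diff ::
  "('v::euclidean_space \<Rightarrow> 'v \<Rightarrow> real) \<Rightarrow> ('v \<Rightarrow> 'v \<Rightarrow> 'v \<Rightarrow> real) \<Rightarrow> 'v \<Rightarrow> 'v \<Rightarrow> 'v" where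
  "left_diff B \<eta> X =
     chart_diff (orbit_chart B \<eta>) (orbit_chart B \<eta>) (\<lambda>k. gtrans B \<eta> X \<otimes>\<^bsub>Lgroup B \<eta>\<^esub> k) 0"

definition Lendo ::
  "('v::euclidean_space \<Rightarrow> 'v \<Rightarrow> real) \<Rightarrow> ('v \<Rightarrow> 'v \<Rightarrow> 'v \<Rightarrow> real) \<Rightarrow> ('v \<Rightarrow> 'v) \<Rightarrow>
   ('v \<Rightarrow> 'v, 'v) endo_field" where
  "Lendo B \<eta> J = (\<lambda>c X u. left_diff B \<eta> X (J (inv_into UNIV (left_diff B \<eta> X) u)))"

text \<open>\<open>\<Gamma> \ L(\<eta>)\<close> is the set of cosets \<open>\<Gamma> g\<close>.\<close>

definition Lproj ::
  "('v::euclidean_space \<Rightarrow> 'v \<Rightarrow> real) \<Rightarrow> ('v \<Rightarrow> 'v \<Rightarrow> 'v \<Rightarrow> real) \<Rightarrow> ('v \<Rightarrow> 'v) set \<Rightarrow>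
   ('v \<Rightarrow> 'v) \<Rightarrow> ('v \<Rightarrow> 'v) set" where
  "Lproj B \<eta> \<Gamma> g = \<Gamma> #>\<^bsub>Lgroup B \<eta>\<^esub> g"

definition Mtop ::
  "('v::euclidean_space \<Rightarrow> 'v \<Rightarrow> real) \<Rightarrow> ('v \<Rightarrow> 'v \<Rightarrow> 'v \<Rightarrow> real) \<Rightarrow> ('v \<Rightarrow> 'v) set \<Rightarrow>
   ('v \<Rightarrow> 'v) set topology" where
  "Mtop B \<eta> \<Gamma> = quot_topology (Ltop B \<eta>) (Lproj B \<eta> \<Gamma>)"

definition Matlas ::
  "('v::euclidean_space \<Rightarrow> 'v \<Rightarrow> real) \<Rightarrow> ('v \<Rightarrow> 'v \<Rightarrow> 'v \<Rightarrow> real) \<Rightarrow> ('v \<Rightarrow> 'v) set \<Rightarrow>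
   (('v \<Rightarrow> 'v) set, 'v) chart set" where
  "Matlas B \<eta> \<Gamma> = quot_atlas (Ltop B \<eta>) {orbit_chart B \<eta>} (Lproj B \<eta> \<Gamma>)"

definition lattice_in_L ::
  "('v::euclidean_space \<Rightarrow> 'v \<Rightarrow> real) \<Rightarrow> ('v \<Rightarrow> 'v \<Rightarrow> 'v \<Rightarrow> real) \<Rightarrow> ('v \<Rightarrow> 'v) set \<Rightarrow> bool" where
  "lattice_in_L B \<eta> \<Gamma> \<longleftrightarrow>
     subgroup \<Gamma> (Lgroup B \<eta>) \<and>
     subtopology (Ltop B \<eta>) \<Gamma> = discrete_topology \<Gamma> \<and>
     compact_space (Mtop B \<eta> \<Gamma>)"

text \<open>
  The structure on the quotient induced by the left-invariant structure \<open>(h, J)\<close>: the projection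
  satisfies \<open>\<pi>\<^sup>* h\<^sub>M = h\<close> and \<open>d\<pi> \<circ> J = J\<^sub>M \<circ> d\<pi>\<close>. As \<open>\<pi>\<close> is a surjective local diffeomorphism,
  this determines \<open>h\<^sub>M\<close> and \<open>J\<^sub>M\<close>.
\<close>

definition induced_structure ::
  "('v::euclidean_space \<Rightarrow> 'v \<Rightarrow> real) \<Rightarrow> ('v \<Rightarrow> 'v \<Rightarrow> 'v \<Rightarrow> real) \<Rightarrow> ('v \<Rightarrow> 'v) \<Rightarrow> ('v \<Rightarrow> 'v) set \<Rightarrow>
   (('v \<Rightarrow> 'v) set, 'v) metric_field \<Rightarrow> (('v \<Rightarrow> 'v) set, 'v) endo_field \<Rightarrow> bool" where
  "induced_structure B \<eta> J \<Gamma> hM JM \<longleftrightarrow>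
     preserves_metric {orbit_chart B \<eta>} (Lmetric B) (Matlas B \<eta> \<Gamma>) hM (Lproj B \<eta> \<Gamma>) \<and>
     preserves_endo {orbit_chart B \<eta>} (Lendo B \<eta> J) (Matlas B \<eta> \<Gamma>) JM (Lproj B \<eta> \<Gamma>)"

end

theory Submission
  imports Defs
begin

text \<open>
  In the orbit chart \<open>L(\<eta>)\<close> is \<open>V\<close> with the product \<open>X + Y + \<eta>\<^sub>X Y\<close>, the metric is the
  constant \<open>B\<close>, and \<open>J\<close> becomes the field \<open>J\<^sub>X = J + 2 \<eta>\<^sub>X J\<close>, whose flat covariant derivative
  \<open>2 \<eta>\<^sub>u J\<close> vanishes on \<open>u\<close>. This gives the nearly (para-)Kaehler condition.

  A lattice exists because \<open>V\<close> has a basis containing a basis of the support of \<open>\<eta>\<close> in which the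
  structure constants are rational: take integral multiples of the basis vectors by a common
  denominator.

  An automorphism of \<open>M\<close> lifts to an affine isometry of \<open>V\<close> that permutes the vectors
  \<open>l\<^sub>X = (1 - \<eta>\<^sub>X) l\<close> of geodesic loops, where \<open>l\<close> runs through the lattice. Now
  \<open>B l\<^sub>X (J\<^sub>X m\<^sub>X) = B l (J m) - 4 \<eta> X l (J m)\<close>. On a homogeneous \<open>M\<close> this number takes only
  countably many values as \<open>X\<close> varies, as it already occurs at the base point, so its linear part
  vanishes. Since the lattice and the support of \<open>\<eta>\<close> together span \<open>V\<close>, it follows that \<open>\<eta> = 0\<close>.
\<close>

section \<open>Isometries of constant metrics\<close>

text \<open>The set \<open>T\<close> is a full neighbourhood and need not lie in \<open>S\<close>,
  so derivatives at points of \<open>S\<close> are determined without assuming \<open>S\<close>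
  open. Linear part and constant may vary from point to point.\<close>

definition locally_affine :: "'v::euclidean_space set \<Rightarrow> ('v \<Rightarrow> 'b::real_normed_vector) \<Rightarrow> bool" where
  "locally_affine S f \<longleftrightarrow>
     (\<forall>x\<in>S. \<exists>T a b. open T \<and> x \<in> T \<and> linear a \<and> (\<forall>y\<in>T. f y = a y + b))"

lemma affine_on_open_has_derivative:
  fixes f :: "'v::euclidean_space \<Rightarrow> 'b::real_normed_vector"
  assumes "open T" "x \<in> T" "linear a" "\<And>y. y \<in> T \<Longrightarrow> f y = a y + b"
  shows "(f has_derivative a) (at x)"
proof -
  have "bounded_linear a"
    using assms(3) by (simp add: linear_conv_bounded_linear)
  then have "((\<lambda>y. a y + b) has_derivative (\<lambda>u. a u + 0)) (at x)"
    by (intro derivative_intros bounded_linear.has_derivative[of a]) auto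
  then show ?thesis
    using has_derivative_transform_within_open[of "\<lambda>y. a y + b" a x UNIV T f] assms by simp
qed

lemma affine_on_open_frechet_derivative:
  fixes f :: "'v::euclidean_space \<Rightarrow> 'b::real_normed_vector"
  assumes "open T" "x \<in> T" "linear a" "\<And>y. y \<in> T \<Longrightarrow> f y = a y + b"
  shows "frechet_derivative f (at x) = a"
  using affine_on_open_has_derivative[OF assms] frechet_derivative_at by metis

text \<open>Directional derivatives of a locally affine map are locally constant, hence again
  locally affine, which is what the induction on \<open>k\<close> needs.\<close>

lemma locally_affine_imp_Ck_on: "locally_affine S f \<Longrightarrow> Ck_on k S f"
proof (induction k arbitrary: f)
  case 0
  have "isCont f x" if x: "x \<in> S" for x
    using 0 x affine_on_open_has_derivative has_derivative_continuous
    unfolding locally_affine_def by metis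
  then show ?case
    by (simp add: continuous_at_imp_continuous_on)
next
  case (Suc k)
  have "f differentiable (at x)" if x: "x \<in> S" for x
    using Suc.prems x affine_on_open_has_derivative
    unfolding locally_affine_def differentiable_def by metis
  moreover have "locally_affine S (\<lambda>x. frechet_derivative f (at x) v)" for v
    unfolding locally_affine_def
  proof
    fix x assume "x \<in> S"
    then obtain T a b where T: "open T" "x \<in> T" "linear a" "\<forall>y\<in>T. f y = a y + b"
      using Suc.prems unfolding locally_affine_def by blast
    then have "\<forall>y\<in>T. frechet_derivative f (at y) v = 0 + a v"
      using affine_on_open_frechet_derivative by fastforce
    moreover have "linear (\<lambda>y::'a. 0::'b)"
      by (simp add: linear_iff)
    ultimately show "\<exists>T c d. open T \<and> x \<in> T \<and> linear c \<and>
        (\<forall>y\<in>T. frechet_derivative f (at y) v = c y + d)"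
      using T(1,2) by blast
  qed
  ultimately show ?case
    using Suc.IH by simp
qed

lemma locally_affine_imp_smooth_on: "locally_affine S f \<Longrightarrow> smooth_on S f"
  by (simp add: smooth_on_def locally_affine_imp_Ck_on)

section \<open>Symmetry of second derivatives\<close>

lemma has_real_derivative_along_line:
  fixes f :: "'v::real_normed_vector \<Rightarrow> real"
  assumes "(f has_derivative f') (at (p + s *\<^sub>R u))"
  shows "((\<lambda>s. f (p + s *\<^sub>R u)) has_real_derivative f' u) (at s)"
proof -
  have "((\<lambda>s. p + s *\<^sub>R u) has_derivative (\<lambda>t. 0 + t *\<^sub>R u)) (at s)"
    by (intro derivative_intros)
  from has_derivative_compose[OF this, of f f'] assms
  have "((\<lambda>s. f (p + s *\<^sub>R u)) has_derivative (\<lambda>t. f' (t *\<^sub>R u))) (at s)"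
    by simp
  moreover have "(\<lambda>t. f' (t *\<^sub>R u)) = (\<lambda>t. t * f' u)"
    using assms has_derivative_linear linear_scale by (metis real_scaleR_def)
  ultimately show ?thesis
    by (simp add: has_field_derivative_def mult.commute[of _ "f' u"])
qed

text \<open>The mean value theorem is applied twice, first in direction \<open>u\<close> to the
  difference of two parallel line restrictions, then in direction \<open>v\<close> to the resulting
  first derivative.\<close>

lemma second_difference_mvt:
  fixes f :: "'v::real_normed_vector \<Rightarrow> real"
  assumes "\<And>y. y \<in> ball x r \<Longrightarrow> (f has_derivative f' y) (at y)"
    and "\<And>y. y \<in> ball x r \<Longrightarrow> ((\<lambda>z. f' z u) has_derivative f'' y) (at y)"
    and h: "0 < h" "h * (norm u + norm v) < r"
  shows "\<exists>y \<in> cball x (h * (norm u + norm v)).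
    f (x + h *\<^sub>R u + h *\<^sub>R v) - f (x + h *\<^sub>R u) - f (x + h *\<^sub>R v) + f x = h * h * f'' y v"
proof -
  have in_cball: "x + s *\<^sub>R u + t *\<^sub>R v \<in> cball x (h * (norm u + norm v))"
    if "0 \<le> s" "s \<le> h" "0 \<le> t" "t \<le> h" for s t
  proof -
    have "norm (s *\<^sub>R u + t *\<^sub>R v) \<le> s * norm u + t * norm v"
      using that by (metis abs_of_nonneg norm_scaleR norm_triangle_ineq)
    also have "\<dots> \<le> h * norm u + h * norm v"
      using that by (intro add_mono mult_right_mono) auto
    finally have "norm (s *\<^sub>R u + t *\<^sub>R v) \<le> h * (norm u + norm v)"
      by (simp add: algebra_simps)
    moreover have "x - (x + s *\<^sub>R u + t *\<^sub>R v) = - (s *\<^sub>R u + t *\<^sub>R v)" by simp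
    ultimately show ?thesis
      unfolding mem_cball dist_norm by (metis norm_minus_cancel)
  qed
  then have in_ball: "x + s *\<^sub>R u + t *\<^sub>R v \<in> ball x r"
    if "0 \<le> s" "s \<le> h" "0 \<le> t" "t \<le> h" for s t
    using that h(2) by (meson mem_ball mem_cball order_le_less_trans)
  define G where "G s = f (x + h *\<^sub>R v + s *\<^sub>R u) - f (x + s *\<^sub>R u)" for s
  have "(G has_real_derivative (f' (x + h *\<^sub>R v + s *\<^sub>R u) u - f' (x + s *\<^sub>R u) u)) (at s)"
    if "0 \<le> s" "s \<le> h" for s
    unfolding G_def
    using in_ball[OF that, of h] in_ball[OF that, of 0] h(1)
    by (intro DERIV_diff has_real_derivative_along_line assms(1)) (auto simp: algebra_simps)
  from MVT2[OF h(1) this] obtain s where s: "0 < s" "s < h"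
    and Gs: "G h - G 0 = h * (f' (x + h *\<^sub>R v + s *\<^sub>R u) u - f' (x + s *\<^sub>R u) u)"
    by auto
  have "((\<lambda>t. f' (x + s *\<^sub>R u + t *\<^sub>R v) u) has_real_derivative f'' (x + s *\<^sub>R u + t *\<^sub>R v) v) (at t)"
    if "0 \<le> t" "t \<le> h" for t
    using has_real_derivative_along_line[OF assms(2)] in_ball[of s t] s that by simp
  from MVT2[OF h(1) this] obtain t where t: "0 < t" "t < h"
    and "f' (x + s *\<^sub>R u + h *\<^sub>R v) u - f' (x + s *\<^sub>R u) u = h * f'' (x + s *\<^sub>R u + t *\<^sub>R v) v"
    by auto
  then have "G h - G 0 = h * h * f'' (x + s *\<^sub>R u + t *\<^sub>R v) v"
    using Gs by (simp add: algebra_simps)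
  then show ?thesis
    using in_cball[of s t] s t by (intro bexI) (auto simp: G_def algebra_simps)
qed

text \<open>The second difference is symmetric in \<open>u\<close> and \<open>v\<close>. Hence the
  two mixed derivatives coincide at two points arbitrarily close to \<open>x\<close>, and continuity
  at \<open>x\<close> finishes.\<close>

lemma second_derivative_symmetric_real:
  fixes f :: "'v::real_normed_vector \<Rightarrow> real"
  assumes "open S" "x \<in> S"
    and f': "\<And>y. y \<in> S \<Longrightarrow> (f has_derivative f' y) (at y)"
    and f'': "\<And>y u. y \<in> S \<Longrightarrow> ((\<lambda>z. f' z u) has_derivative f'' u y) (at y)"
    and cont: "\<And>u v. continuous_on S (\<lambda>y. f'' u y v)"
  shows "f'' u x v = f'' v x u"
proof (rule ccontr)
  assume neq: "f'' u x v \<noteq> f'' v x u"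
  \<comment> \<open>Half of the supposed gap: two errors below \<open>e\<close> contradict
    it.\<close>
  define e where "e = \<bar>f'' u x v - f'' v x u\<bar> / 2"
  have e: "e > 0" using neq by (simp add: e_def)
  obtain r where r: "r > 0" "ball x r \<subseteq> S"
    using assms(1,2) open_contains_ball by blast
  have "isCont (\<lambda>y. f'' u y v) x" "isCont (\<lambda>y. f'' v y u) x"
    using cont assms(1,2) by (simp_all add: continuous_on_eq_continuous_at)
  then obtain d1 d2 where d: "d1 > 0" "d2 > 0"
    "\<And>y. dist y x < d1 \<Longrightarrow> dist (f'' u y v) (f'' u x v) < e"
    "\<And>y. dist y x < d2 \<Longrightarrow> dist (f'' v y u) (f'' v x u) < e"
    using e unfolding continuous_at_eps_delta by metis
  define d where "d = min r (min d1 d2)"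
  have "d > 0" using r d by (simp add: d_def)
  define n where "n = norm u + norm v"
  have n: "n \<ge> 0" by (simp add: n_def)
  \<comment> \<open>Makes \<open>h * n < d\<close>; the summand 1 keeps the denominator positive
    when \<open>u\<close> and \<open>v\<close> both vanish.\<close>
  define h where "h = d / (2 * (n + 1))"
  have h0: "0 < h" using \<open>d > 0\<close> n by (simp add: h_def)
  have "h * n < h * (2 * (n + 1))"
    using h0 n by (intro mult_strict_left_mono) auto
  also have "\<dots> = d" using n by (simp add: h_def)
  finally have hn: "h * n < d" .
  then have hr: "h * n < r" "h * n < d1" "h * n < d2" by (auto simp: d_def)
  obtain y where y: "y \<in> cball x (h * n)"
    "f (x + h *\<^sub>R u + h *\<^sub>R v) - f (x + h *\<^sub>R u) - f (x + h *\<^sub>R v) + f x = h * h * f'' u y v"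
    using second_difference_mvt[of x r f f' u "f'' u" h v] f' f'' r(2) h0 hr(1)
    unfolding n_def by blast
  obtain z where z: "z \<in> cball x (h * n)"
    "f (x + h *\<^sub>R v + h *\<^sub>R u) - f (x + h *\<^sub>R v) - f (x + h *\<^sub>R u) + f x = h * h * f'' v z u"
    using second_difference_mvt[of x r f f' v "f'' v" h u] f' f'' r(2) h0 hr(1)
    unfolding n_def add.commute[of "norm u"] by blast
  have "x + h *\<^sub>R v + h *\<^sub>R u = x + h *\<^sub>R u + h *\<^sub>R v" by simp
  then have "h * h * f'' u y v = h * h * f'' v z u" using y(2) z(2) unfolding \<open>x + h *\<^sub>R v + h *\<^sub>R u = _\<close> by linarith
  then have "f'' u y v = f'' v z u" using h0 by simp
  moreover have "dist (f'' u y v) (f'' u x v) < e" "dist (f'' v z u) (f'' v x u) < e"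
    using d(3)[of y] d(4)[of z] y(1) z(1) hr(2,3) by (simp_all add: dist_commute[of x])
  ultimately have "dist (f'' u x v) (f'' v x u) < e + e"
    by (metis dist_commute dist_triangle_less_add)
  then show False
    unfolding e_def dist_real_def by simp
qed

lemma second_derivative_symmetric:
  fixes f :: "'v::real_normed_vector \<Rightarrow> 'b::real_inner"
  assumes "open S" "x \<in> S"
    and f': "\<And>y. y \<in> S \<Longrightarrow> (f has_derivative f' y) (at y)"
    and f'': "\<And>y u. y \<in> S \<Longrightarrow> ((\<lambda>z. f' z u) has_derivative f'' u y) (at y)"
    and cont: "\<And>u v. continuous_on S (\<lambda>y. f'' u y v)"
  shows "f'' u x v = f'' v x u"
proof -
  have "f'' u x v \<bullet> w = f'' v x u \<bullet> w" for w
  proof (rule second_derivative_symmetric_real[OF assms(1,2)])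
    show "((\<lambda>y. f y \<bullet> w) has_derivative (\<lambda>u. f' y u \<bullet> w)) (at y)" if "y \<in> S" for y
      using f'[OF that] by (rule has_derivative_inner_left)
    show "((\<lambda>z. f' z u \<bullet> w) has_derivative (\<lambda>v. f'' u y v \<bullet> w)) (at y)" if "y \<in> S" for y u
      using f''[OF that] by (rule has_derivative_inner_left)
    show "continuous_on S (\<lambda>y. f'' u y v \<bullet> w)" for u v
      using cont by (intro continuous_intros)
  qed
  then show ?thesis
    by (metis inner_commute vector_eq_ldot)
qed

text \<open>
  The third-order tensor \<open>B (D\<^sup>2 f (u, v)) (D f w)\<close> is symmetric in \<open>u\<close>, \<open>v\<close> and skew in
  \<open>v\<close>, \<open>w\<close>, hence zero.
\<close>

lemma isometric_Ck_2_imp_locally_affine: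
  fixes f :: "'v::euclidean_space \<Rightarrow> 'v"
  assumes B: "scalar_product B" and S: "open S" and C2: "Ck_on (Suc (Suc 0)) S f"
    and iso: "\<And>x u v. x \<in> S \<Longrightarrow>
      B (frechet_derivative f (at x) u) (frechet_derivative f (at x) v) = B u v"
  shows "locally_affine S f"
proof -
  define f' where "f' y = frechet_derivative f (at y)" for y
  define f'' where "f'' u y = frechet_derivative (\<lambda>z. f' z u) (at y)" for u y
  have bil: "bilinear B" and sym: "\<And>u v. B u v = B v u" and nondeg: "\<And>u. (\<forall>v. B u v = 0) \<Longrightarrow> u = 0"
    using B unfolding scalar_product_def by auto
  have f': "(f has_derivative f' y) (at y)" if "y \<in> S" for y
    using C2 that by (simp add: f'_def frechet_derivative_works[symmetric])
  have f'': "((\<lambda>z. f' z u) has_derivative f'' u y) (at y)" if "y \<in> S" for y u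
    using C2 that by (simp add: f''_def f'_def frechet_derivative_works[symmetric])
  have cont: "continuous_on S (\<lambda>y. f'' u y v)" for u v
    using C2 by (simp add: f''_def f'_def)
  have bb: "bounded_bilinear B"
    using bil by (simp add: bilinear_conv_bounded_bilinear)
  have "f'' u y v = 0" if y: "y \<in> S" for u v y
  proof -
    have sym2: "f'' u y v = f'' v y u" for u v
      by (rule second_derivative_symmetric[OF S y f' f'' cont])
    have skew: "B (f'' v y u) (f' y w) = - B (f' y v) (f'' w y u)" for u v w
    proof -
      have "((\<lambda>z. B (f' z v) (f' z w)) has_derivative
          (\<lambda>u. B (f' y v) (f'' w y u) + B (f'' v y u) (f' y w))) (at y)"
        by (rule bounded_bilinear.FDERIV[OF bb f''[OF y] f''[OF y]])
      moreover have "((\<lambda>z. B (f' z v) (f' z w)) has_derivative (\<lambda>u. 0)) (at y)"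
        by (rule has_derivative_transform_within_open[OF has_derivative_const[of "B v w"] S y])
          (simp add: iso f'_def)
      ultimately have "(\<lambda>u. B (f' y v) (f'' w y u) + B (f'' v y u) (f' y w)) = (\<lambda>u. 0)"
        by (rule has_derivative_unique)
      then show ?thesis
        by (metis add.commute add_eq_0_iff)
    qed
    define \<tau> where "\<tau> u v w = B (f'' v y u) (f' y w)" for u v w
    have \<tau>1: "\<tau> u v w = \<tau> v u w" and \<tau>2: "\<tau> u v w = - \<tau> u w v" for u v w
      using sym2[of u v] skew[of v u w] sym by (simp_all add: \<tau>_def)
    \<comment> \<open>Alternating the two symmetries six times returns to the same arguments with
      three sign changes.\<close>
    have \<tau>0: "\<tau> u v w = 0" for u v w
      using \<tau>1[of u v w] \<tau>2[of v u w] \<tau>1[of v w u] \<tau>2[of w v u] \<tau>1[of w u v] \<tau>2[of u w v]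
      by simp
    have "linear (f' y)" using f'[OF y] by (rule has_derivative_linear)
    moreover have "inj (f' y)"
    proof (unfold linear_injective_0[OF \<open>linear (f' y)\<close>], intro allI impI)
      fix a assume "f' y a = 0"
      then have "B a c = 0" for c
        using iso[OF y, of a c] bil by (simp add: f'_def bilinear_lzero)
      then show "a = 0" using nondeg by blast
    qed
    ultimately have "surj (f' y)" by (simp add: linear_inj_imp_surj)
    then have "B (f'' u y v) w = 0" for w
      using \<tau>0[of v u] unfolding \<tau>_def by (metis surjD)
    then show ?thesis using nondeg by blast
  qed
  note f''0 = this
  show ?thesis
    unfolding locally_affine_def
  proof
    fix x assume x: "x \<in> S"
    then obtain r where r: "r > 0" "ball x r \<subseteq> S"
      using S open_contains_ball by blast
    \<comment> \<open>Vanishing second derivatives make \<open>f'\<close> constant on the ball; then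
      \<open>f - f' x\<close> has zero derivative there and is constant too.\<close>
    have f'_const: "f' y u = f' x u" if y: "y \<in> ball x r" for y u
    proof -
      have "((\<lambda>z. f' z u) has_derivative (\<lambda>_. 0)) (at z within ball x r)" if "z \<in> ball x r" for z
      proof -
        have "z \<in> S" using that r(2) by blast
        then have "f'' u z = (\<lambda>_. 0)" using f''0 by blast
        then show ?thesis
          using f''[OF \<open>z \<in> S\<close>, of u] has_derivative_at_withinI by metis
      qed
      from has_derivative_zero_constant[OF convex_ball this]
      obtain c where "\<And>z. z \<in> ball x r \<Longrightarrow> f' z u = c" by blast
      then show ?thesis using y r(1) by (metis centre_in_ball)
    qed
    have "((\<lambda>z. f z - f' x z) has_derivative (\<lambda>_. 0)) (at z within ball x r)" if z: "z \<in> ball x r" for z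
    proof -
      have zS: "z \<in> S" using z r(2) by blast
      have "f' z = f' x" using f'_const[OF z] by blast
      then have "(f has_derivative f' x) (at z)" using f'[OF zS] by simp
      moreover have "(f' x has_derivative f' x) (at z)"
        using f'[OF x] has_derivative_bounded_linear bounded_linear_imp_has_derivative by blast
      ultimately have "((\<lambda>z. f z - f' x z) has_derivative (\<lambda>u. f' x u - f' x u)) (at z)"
        by (rule has_derivative_diff)
      then show ?thesis by (simp add: has_derivative_at_withinI)
    qed
    from has_derivative_zero_constant[OF convex_ball this]
    obtain c where "\<And>z. z \<in> ball x r \<Longrightarrow> f z - f' x z = c" by blast
    then have "\<forall>z\<in>ball x r. f z = f' x z + c" by (metis add.commute diff_add_cancel)
    moreover have "linear (f' x)" using f'[OF x] by (rule has_derivative_linear)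
    ultimately show "\<exists>T a b. open T \<and> x \<in> T \<and> linear a \<and> (\<forall>y\<in>T. f y = a y + b)"
      using r(1) by (intro exI[of _ "ball x r"] exI[of _ "f' x"] exI[of _ c]) auto
  qed
qed

section \<open>The group in the orbit chart\<close>

text \<open>Non-degeneracy makes the map from V to its dual injective, hence bijective by dimension;
  \<open>F\<close> is this map in coordinates. The uniqueness gives meaning to the definite
  description in \<open>contr\<close>.\<close>

lemma scalar_product_represents:
  fixes B :: "'v::euclidean_space \<Rightarrow> 'v \<Rightarrow> real"
  assumes "scalar_product B" "linear \<phi>"
  shows "\<exists>!w. \<forall>z. B w z = \<phi> z"
proof -
  have bil: "bilinear B" and nondeg: "\<And>u. (\<forall>v. B u v = 0) \<Longrightarrow> u = 0"
    using assms(1) unfolding scalar_product_def by auto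
  have linB: "linear (B w)" and linB': "linear (\<lambda>w. B w z)" for w z
    using bil by (simp_all add: bilinear_def)
  define F where "F w = (\<Sum>b\<in>Basis. B w b *\<^sub>R b)" for w
  have lin: "linear F"
    unfolding F_def
    by (intro linear_compose_sum ballI) (use linB' in \<open>simp add: linear_iff scaleR_left_distrib\<close>)
  have F_nth: "F w \<bullet> b = B w b" if "b \<in> Basis" for w b
    using that by (simp add: F_def)
  have B_eqI: "B w z = \<phi> z" if "\<And>b. b \<in> Basis \<Longrightarrow> B w b = \<phi> b" for w z
    using linear_eq_on_span[OF linB[of w] assms(2), of Basis] that
    by (metis UNIV_I span_Basis)
  have "inj F"
  proof (unfold linear_injective_0[OF lin], intro allI impI)
    fix w assume "F w = 0"
    then have "B w b = 0" if "b \<in> Basis" for b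
      using F_nth[OF that, of w] by simp
    then have "B w z = 0" for z
      using linear_eq_on_span[OF linB[of w] linear_zero, of Basis] by (metis UNIV_I span_Basis)
    then show "w = 0" using nondeg by blast
  qed
  then have "surj F" using lin by (rule linear_inj_imp_surj[rotated])
  then obtain w where "F w = (\<Sum>b\<in>Basis. \<phi> b *\<^sub>R b)" by (metis surjD)
  then have "B w b = \<phi> b" if "b \<in> Basis" for b
    using F_nth[OF that, of w] that by simp
  then have w: "\<forall>z. B w z = \<phi> z" using B_eqI by blast
  moreover have "w' = w" if "\<forall>z. B w' z = \<phi> z" for w'
  proof -
    have "B (w' - w) z = 0" for z
      using that w linear_diff[OF linB'[of z], of w' w] by simp
    then show ?thesis using nondeg by (metis eq_iff_diff_eq_0)
  qed
  ultimately show ?thesis by blast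
qed

section \<open>The contraction of the form and the isotropy of its support\<close>

locale isotropic_three_form =
  fixes B :: "'v::euclidean_space \<Rightarrow> 'v \<Rightarrow> real"
    and \<eta> :: "'v \<Rightarrow> 'v \<Rightarrow> 'v \<Rightarrow> real"
  assumes scalar_product: "scalar_product B"
    and alternating: "alternating3 \<eta>"
    and isotropic: "totally_isotropic B (supp3 B \<eta>)"
begin

abbreviation e :: "'v \<Rightarrow> 'v \<Rightarrow> 'v" where
  "e \<equiv> contr B \<eta>"

lemma bilinear_B: "bilinear B" and B_commute: "B u v = B v u"
  and B_nondegenerate: "(\<And>v. B u v = 0) \<Longrightarrow> u = 0"
  using scalar_product unfolding scalar_product_def by auto

lemma B_eqI: "(\<And>z. B u z = B v z) \<Longrightarrow> u = v"
  using B_nondegenerate[of "u - v"] by (simp add: bilinear_lsub[OF bilinear_B])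

lemmas B_simps = bilinear_ladd[OF bilinear_B] bilinear_radd[OF bilinear_B]
  bilinear_lsub[OF bilinear_B] bilinear_rsub[OF bilinear_B]
  bilinear_lneg[OF bilinear_B] bilinear_rneg[OF bilinear_B]
  bilinear_lmul[OF bilinear_B] bilinear_rmul[OF bilinear_B]
  bilinear_lzero[OF bilinear_B] bilinear_rzero[OF bilinear_B]

lemma linear_form: "linear (\<lambda>x. \<eta> x y z)" "linear (\<lambda>y. \<eta> x y z)" "linear (\<eta> x y)"
  using alternating unfolding alternating3_def by auto

lemma form_same: "\<eta> x x z = 0" "\<eta> x z z = 0" "\<eta> x z x = 0"
  using alternating unfolding alternating3_def by auto

lemma form_swap: "\<eta> x z y = - \<eta> x y z" "\<eta> y x z = - \<eta> x y z"
proof -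
  have "\<eta> x (y + z) (y + z) = \<eta> x y z + \<eta> x z y"
    unfolding linear_add[OF linear_form(2)] linear_add[OF linear_form(3)] by (simp add: form_same)
  then show "\<eta> x z y = - \<eta> x y z" by (simp add: form_same)
  have "\<eta> (x + y) (x + y) z = \<eta> x y z + \<eta> y x z"
    unfolding linear_add[OF linear_form(1)] linear_add[OF linear_form(2)] by (simp add: form_same)
  then show "\<eta> y x z = - \<eta> x y z" by (simp add: form_same)
qed

lemma B_e: "B (e X Y) Z = \<eta> X Y Z"
  using theI'[OF scalar_product_represents[OF scalar_product linear_form(3)], of X Y]
  unfolding contr_def by blast

lemma B_e_right: "B Z (e X Y) = \<eta> X Y Z"
  using B_e B_commute by metis

lemma bilinear_e: "bilinear e"
  unfolding bilinear_def
  by (intro allI conjI linearI B_eqI)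
    (simp_all add: B_e B_simps linear_add[OF linear_form(1)] linear_add[OF linear_form(2)]
      linear_scale[OF linear_form(1)] linear_scale[OF linear_form(2)])

lemma bounded_bilinear_e: "bounded_bilinear e"
  using bilinear_e by (simp add: bilinear_conv_bounded_bilinear)

lemmas e_simps = bilinear_ladd[OF bilinear_e] bilinear_radd[OF bilinear_e]
  bilinear_lsub[OF bilinear_e] bilinear_rsub[OF bilinear_e]
  bilinear_lneg[OF bilinear_e] bilinear_rneg[OF bilinear_e]
  bilinear_lmul[OF bilinear_e] bilinear_rmul[OF bilinear_e]
  bilinear_lzero[OF bilinear_e] bilinear_rzero[OF bilinear_e]

lemma e_same: "e X X = 0"
  by (rule B_nondegenerate) (simp add: B_e form_same)

lemma e_swap: "e Y X = - e X Y"
  by (rule B_eqI) (simp add: B_e B_simps form_swap(2)[where x = X and y = Y])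

lemma e_skew: "B (e X Y) Z = - B Y (e X Z)"
  by (simp add: B_e B_e_right form_swap(1)[where x = X and y = Y and z = Z])

lemma e_in_supp3: "e X Y \<in> supp3 B \<eta>"
  unfolding supp3_def by (rule span_base) blast

text \<open>Skewness moves \<open>e X\<close> to the other argument of \<open>B\<close>, and then
  both arguments lie in the isotropic support. This is the source of two-step nilpotency.\<close>

lemma e_supp3:
  assumes "s \<in> supp3 B \<eta>"
  shows "e X s = 0" "e s X = 0"
proof -
  have "B (e X s) Z = 0" for Z
    using e_skew[of X s Z] isotropic assms e_in_supp3
    unfolding totally_isotropic_def by auto
  then show "e X s = 0" using B_nondegenerate by blast
  then show "e s X = 0" using e_swap[of X s] by simp
qed

lemma e_e [simp]: "e X (e Y Z) = 0" "e (e X Y) Z = 0"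
  using e_supp3 e_in_supp3 by blast+

lemma B_e_e [simp]: "B (e X Y) (e X' Y') = 0"
  using isotropic e_in_supp3 unfolding totally_isotropic_def by blast

section \<open>The group law on V\<close>

text \<open>With the bracket \<open>2 e X Y\<close> this is the Baker-Campbell-Hausdorff product of
  a 2-step nilpotent Lie algebra; accordingly the inverse of \<open>X\<close> is
  \<open>- X\<close>.\<close>

definition gmul :: "'v \<Rightarrow> 'v \<Rightarrow> 'v" where
  "gmul X Y = X + Y + e X Y"

lemma gmul_simps [simp]: "gmul 0 X = X" "gmul X 0 = X" "gmul X (- X) = 0" "gmul (- X) X = 0"
  by (simp_all add: gmul_def e_simps e_same)

lemma gmul_assoc: "gmul (gmul X Y) Z = gmul X (gmul Y Z)"
  by (simp add: gmul_def e_simps)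

lemma gmul_cancel [simp]: "gmul (- X) (gmul X Y) = Y" "gmul X (gmul (- X) Y) = Y"
  "gmul (gmul Y X) (- X) = Y" "gmul (gmul Y (- X)) X = Y"
proof -
  show "gmul (- X) (gmul X Y) = Y" "gmul X (gmul (- X) Y) = Y"
    unfolding gmul_assoc[symmetric] by simp_all
  show "gmul (gmul Y X) (- X) = Y" "gmul (gmul Y (- X)) X = Y"
    unfolding gmul_assoc by simp_all
qed

lemma uminus_gmul: "- gmul X Y = gmul (- Y) (- X)"
  by (simp add: gmul_def e_simps e_swap[of X Y])

lemma continuous_on_gmul [continuous_intros]:
  "continuous_on S f \<Longrightarrow> continuous_on S g \<Longrightarrow> continuous_on S (\<lambda>x. gmul (f x) (g x))"
  unfolding gmul_def
  by (intro continuous_intros bounded_bilinear.continuous_on[OF bounded_bilinear_e])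

section \<open>The group of affine maps and its orbit chart\<close>

lemma gtrans_eq: "gtrans B \<eta> X Y = gmul X Y"
  by (simp add: gtrans_def gmul_def)

lemma gtrans_0 [simp]: "gtrans B \<eta> X 0 = X"
  by (simp add: gtrans_eq)

lemma gtrans_comp: "gtrans B \<eta> X \<circ> gtrans B \<eta> Y = gtrans B \<eta> (gmul X Y)"
  by (auto simp: gtrans_eq gmul_assoc)

lemma inj_gtrans: "inj (gtrans B \<eta>)"
  by (metis gtrans_0 injI)

lemma gtrans_zero: "gtrans B \<eta> 0 = id"
  by (auto simp: gtrans_eq)

lemma carrier_Lgroup: "carrier (Lgroup B \<eta>) = range (gtrans B \<eta>)"
  by (simp add: Lgroup_def)

lemma mult_Lgroup: "f \<otimes>\<^bsub>Lgroup B \<eta>\<^esub> g = f \<circ> g"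
  by (simp add: Lgroup_def)

lemma gtrans_mult:
  "gtrans B \<eta> X \<otimes>\<^bsub>Lgroup B \<eta>\<^esub> gtrans B \<eta> Y = gtrans B \<eta> (gmul X Y)"
  by (simp add: mult_Lgroup gtrans_comp)

lemma one_Lgroup: "\<one>\<^bsub>Lgroup B \<eta>\<^esub> = gtrans B \<eta> 0"
  by (simp add: Lgroup_def gtrans_zero)

lemma group_Lgroup: "group (Lgroup B \<eta>)"
proof (rule groupI)
  fix f assume "f \<in> carrier (Lgroup B \<eta>)"
  then obtain X where X: "f = gtrans B \<eta> X" by (auto simp: carrier_Lgroup)
  show "\<exists>g\<in>carrier (Lgroup B \<eta>). g \<otimes>\<^bsub>Lgroup B \<eta>\<^esub> f = \<one>\<^bsub>Lgroup B \<eta>\<^esub>"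
    by (rule bexI[of _ "gtrans B \<eta> (- X)"]) (simp_all add: X gtrans_mult one_Lgroup carrier_Lgroup)
qed (auto simp: carrier_Lgroup one_Lgroup gtrans_mult gmul_assoc)

lemma inv_Lgroup: "inv\<^bsub>Lgroup B \<eta>\<^esub> gtrans B \<eta> X = gtrans B \<eta> (- X)"
  by (rule group.inv_equality[OF group_Lgroup])
    (simp_all add: gtrans_mult one_Lgroup carrier_Lgroup)

text \<open>Allows all topological questions about the group to be settled in V. In the topology of
  pointwise convergence, continuity of \<open>gtrans\<close> is checked at each argument
  separately.\<close>

lemma homeomorphic_maps_gtrans:
  "homeomorphic_maps euclidean (Ltop B \<eta>) (gtrans B \<eta>) (\<lambda>g. g 0)"
proof -
  have "continuous_on UNIV (\<lambda>X. gtrans B \<eta> X Y)" for Y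
    unfolding gtrans_eq by (intro continuous_intros)
  then have "continuous_on UNIV (gtrans B \<eta>)"
    by (rule continuous_on_coordinatewise_then_product)
  moreover have "continuous_on S (\<lambda>g::'v \<Rightarrow> 'v. g 0)" for S
    by (rule continuous_on_subset[OF continuous_on_product_coordinates]) auto
  ultimately show ?thesis
    unfolding homeomorphic_maps_def Ltop_def carrier_Lgroup
    by (auto simp: continuous_map_in_subtopology)
qed

lemma topspace_Ltop: "topspace (Ltop B \<eta>) = range (gtrans B \<eta>)"
  by (simp add: Ltop_def carrier_Lgroup)

lemma openin_Ltop_image: "open U \<Longrightarrow> openin (Ltop B \<eta>) (gtrans B \<eta> ` U)"
  using homeomorphic_imp_open_map[OF homeomorphic_maps_imp_map[OF homeomorphic_maps_gtrans]]
  by (simp add: open_map_def)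

lemma openin_Ltop_vimage: "openin (Ltop B \<eta>) W \<Longrightarrow> open {X. gtrans B \<eta> X \<in> W}"
  using openin_continuous_map_preimage[of euclidean "Ltop B \<eta>" "gtrans B \<eta>" W]
    homeomorphic_maps_gtrans unfolding homeomorphic_maps_def by auto

lemma chart_expr_orbit_chart:
  "chart_expr (orbit_chart B \<eta>) d f X = snd d (f (gtrans B \<eta> X))"
proof -
  have "inv_into (range (gtrans B \<eta>)) (\<lambda>g. g 0) X = gtrans B \<eta> X"
    by (rule inv_into_f_eq) (auto intro!: inj_onI)
  then show ?thesis
    by (simp add: chart_expr_def orbit_chart_def carrier_Lgroup)
qed

lemma left_diff_eq: "left_diff B \<eta> X u = u + e X u"
proof -
  define F where "F = chart_expr (orbit_chart B \<eta>) (orbit_chart B \<eta>)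
    (\<lambda>k. gtrans B \<eta> X \<otimes>\<^bsub>Lgroup B \<eta>\<^esub> k)"
  have "F = (\<lambda>Y. (Y + e X Y) + X)"
  proof
    show "F Y = (Y + e X Y) + X" for Y
      unfolding F_def chart_expr_orbit_chart by (simp add: orbit_chart_def gtrans_mult gmul_def)
  qed
  moreover have "linear (\<lambda>Y. Y + e X Y)"
    by (rule linearI) (simp_all add: e_simps algebra_simps)
  ultimately have "frechet_derivative F (at 0) = (\<lambda>Y. Y + e X Y)"
    using affine_on_open_frechet_derivative[of UNIV 0 "\<lambda>Y. Y + e X Y" F X] by simp
  then show ?thesis
    by (simp add: left_diff_def chart_diff_def F_def)
qed

text \<open>As \<open>e X\<close> squares to zero, \<open>1 - e X\<close> inverts
  \<open>1 + e X\<close>.\<close>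

lemma inv_left_diff: "inv_into UNIV (left_diff B \<eta> X) u = u - e X u"
  by (rule inv_into_f_eq)
    (auto simp: left_diff_eq e_simps intro!: inj_on_inverseI[where g = "\<lambda>w. w - e X w"])

end

section \<open>The quotient manifold\<close>

locale discrete_subgroup_L = isotropic_three_form B \<eta>
  for B :: "'v::euclidean_space \<Rightarrow> 'v \<Rightarrow> real" and \<eta> :: "'v \<Rightarrow> 'v \<Rightarrow> 'v \<Rightarrow> real" +
  fixes \<Gamma> :: "('v \<Rightarrow> 'v) set"
  assumes subgroup_\<Gamma>: "subgroup \<Gamma> (Lgroup B \<eta>)"
    and discrete_\<Gamma>: "subtopology (Ltop B \<eta>) \<Gamma> = discrete_topology \<Gamma>"
begin

text \<open>The subgroup in the orbit chart. It is closed under \<open>gmul\<close>, but not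
  necessarily under addition.\<close>

definition Lam :: "'v set" where
  "Lam = {X. gtrans B \<eta> X \<in> \<Gamma>}"

lemma \<Gamma>_eq: "\<Gamma> = gtrans B \<eta> ` Lam"
  using subgroup.subset[OF subgroup_\<Gamma>] unfolding carrier_Lgroup Lam_def by auto

lemma zero_in_Lam: "0 \<in> Lam"
  using subgroup.one_closed[OF subgroup_\<Gamma>] unfolding one_Lgroup Lam_def by simp

lemma gmul_in_Lam: "a \<in> Lam \<Longrightarrow> b \<in> Lam \<Longrightarrow> gmul a b \<in> Lam"
  using subgroup.m_closed[OF subgroup_\<Gamma>, of "gtrans B \<eta> a" "gtrans B \<eta> b"]
  unfolding gtrans_mult Lam_def by simp

lemma uminus_in_Lam: "a \<in> Lam \<Longrightarrow> - a \<in> Lam"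
  using subgroup.m_inv_closed[OF subgroup_\<Gamma>, of "gtrans B \<eta> a"]
  unfolding inv_Lgroup Lam_def by simp

lemma Lam_isolated_0: "\<exists>U. open U \<and> 0 \<in> U \<and> Lam \<inter> U = {0}"
proof -
  have "openin (subtopology (Ltop B \<eta>) \<Gamma>) {gtrans B \<eta> 0}"
    unfolding discrete_\<Gamma> using zero_in_Lam by (simp add: Lam_def)
  then obtain W where W: "openin (Ltop B \<eta>) W" "{gtrans B \<eta> 0} = W \<inter> \<Gamma>"
    unfolding openin_subtopology by blast
  define U where "U = {X. gtrans B \<eta> X \<in> W}"
  have "X = 0" if "X \<in> Lam \<inter> U" for X
  proof -
    have "gtrans B \<eta> X \<in> W \<inter> \<Gamma>" using that by (simp add: Lam_def U_def)
    then have "gtrans B \<eta> X = gtrans B \<eta> 0" using W(2) by blast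
    then show ?thesis using inj_gtrans by (meson injD)
  qed
  moreover have "0 \<in> Lam \<inter> U" using W(2) zero_in_Lam by (auto simp: U_def)
  moreover have "open U" unfolding U_def using W(1) by (rule openin_Ltop_vimage)
  ultimately show ?thesis by blast
qed

lemma gmul_neighbourhoods:
  assumes "open U" "gmul x y \<in> U"
  shows "\<exists>V W. open V \<and> open W \<and> x \<in> V \<and> y \<in> W \<and> (\<forall>a\<in>V. \<forall>b\<in>W. gmul a b \<in> U)"
proof -
  have "continuous_on UNIV (\<lambda>p. gmul (fst p) (snd p))"
    by (intro continuous_intros)
  then have "open ((\<lambda>p. gmul (fst p) (snd p)) -` U)"
    using assms(1) by (simp add: open_vimage)
  moreover have "(x, y) \<in> (\<lambda>p. gmul (fst p) (snd p)) -` U" using assms(2) by simp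
  ultimately obtain V W where "open V" "open W" "(x, y) \<in> V \<times> W"
    "V \<times> W \<subseteq> (\<lambda>p. gmul (fst p) (snd p)) -` U"
    by (rule open_prod_elim)
  then show ?thesis by (intro exI[of _ V] exI[of _ W]) auto
qed

lemma gmul_uminus_neighbourhoods:
  assumes "open U" "gmul x (- y) \<in> U"
  shows "\<exists>V W. open V \<and> open W \<and> x \<in> V \<and> y \<in> W \<and> (\<forall>a\<in>V. \<forall>b\<in>W. gmul a (- b) \<in> U)"
proof -
  obtain V W where VW: "open V" "open W" "x \<in> V" "- y \<in> W" "\<forall>a\<in>V. \<forall>b\<in>W. gmul a b \<in> U"
    using gmul_neighbourhoods[OF assms] by blast
  have "open (uminus ` W)" using VW(2) by (rule open_negations)
  moreover have "y \<in> uminus ` W" using VW(4) by force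
  ultimately show ?thesis using VW by (intro exI[of _ V] exI[of _ "uminus ` W"]) auto
qed

text \<open>If \<open>a\<close> and \<open>b\<close> are close to \<open>y\<close>, then
  \<open>gmul a (- b)\<close> is close to 0, the only lattice element there. This spreads
  discreteness from 0 to every point of V, in the lattice or not.\<close>

lemma Lam_at_most_one_near: "\<exists>U. open U \<and> y \<in> U \<and> (\<forall>a\<in>U. \<forall>b\<in>U. gmul a (- b) \<in> Lam \<longrightarrow> a = b)"
proof -
  obtain U where U: "open U" "0 \<in> U" "Lam \<inter> U = {0}" using Lam_isolated_0 by blast
  obtain V W where VW: "open V" "open W" "y \<in> V" "y \<in> W" "\<forall>a\<in>V. \<forall>b\<in>W. gmul a (- b) \<in> U"
    using gmul_uminus_neighbourhoods[of U y y] U by auto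
  have "a = b" if "a \<in> V \<inter> W" "b \<in> V \<inter> W" "gmul a (- b) \<in> Lam" for a b
  proof -
    have "gmul a (- b) = 0" using that VW(5) U(3) by blast
    then show ?thesis by (metis gmul_cancel(4) gmul_simps(1))
  qed
  then show ?thesis using VW by (intro exI[of _ "V \<inter> W"]) auto
qed

text \<open>A small neighbourhood of any point holds at most one lattice element. The closedness
  that follows serves the Hausdorff property, the countability serves inhomogeneity.\<close>

lemma Lam_sparse: "Lam sparse_in UNIV"
  unfolding sparse_in_def
proof
  fix y :: 'v
  obtain U where U: "open U" "y \<in> U" "\<forall>a\<in>U. \<forall>b\<in>U. gmul a (- b) \<in> Lam \<longrightarrow> a = b"
    using Lam_at_most_one_near by blast
  have "\<not> z islimpt Lam" if "z \<in> U" for z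
  proof
    assume "z islimpt Lam"
    then have inf: "infinite (U \<inter> Lam)"
      using U(1) that by (simp add: islimpt_eq_acc_point)
    have "a = b" if "a \<in> U \<inter> Lam" "b \<in> U \<inter> Lam" for a b
      using that U(3) gmul_in_Lam uminus_in_Lam by blast
    then have sub: "U \<inter> Lam \<subseteq> {a}" if "a \<in> U \<inter> Lam" for a using that by blast
    obtain a where "a \<in> U \<inter> Lam" using inf infinite_imp_nonempty by blast
    then have "finite (U \<inter> Lam)" using sub[of a] finite_subset[of _ "{a}"] by simp
    then show False using inf by simp
  qed
  then show "\<exists>U. y \<in> U \<and> open U \<and> (\<forall>z\<in>U. \<not> z islimpt Lam)" using U by blast
qed

lemma closed_Lam: "closed Lam"
  using Lam_sparse by (rule sparse_in_UNIV_imp_closed)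

lemma countable_Lam: "countable Lam"
  using sparse_imp_countable[OF open_UNIV Lam_sparse] by simp

section \<open>The projection and the topology of the quotient\<close>

text \<open>The projection read in the orbit chart, so that V itself serves as the covering space of
  the quotient.\<close>

definition q :: "'v \<Rightarrow> ('v \<Rightarrow> 'v) set" where
  "q X = Lproj B \<eta> \<Gamma> (gtrans B \<eta> X)"

lemma q_eq: "q X = gtrans B \<eta> ` {gmul l X | l. l \<in> Lam}"
proof -
  have "q X = (\<lambda>h. h \<otimes>\<^bsub>Lgroup B \<eta>\<^esub> gtrans B \<eta> X) ` \<Gamma>"
    unfolding q_def Lproj_def r_coset_def by blast
  also have "\<dots> = (\<lambda>h. h \<otimes>\<^bsub>Lgroup B \<eta>\<^esub> gtrans B \<eta> X) ` gtrans B \<eta> ` Lam"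
    using \<Gamma>_eq by (rule arg_cong)
  also have "\<dots> = gtrans B \<eta> ` (\<lambda>l. gmul l X) ` Lam"
    unfolding image_image gtrans_mult ..
  finally show ?thesis
    by (simp only: setcompr_eq_image Collect_mem_eq)
qed

lemma q_eq_iff: "q X = q Y \<longleftrightarrow> (\<exists>l\<in>Lam. Y = gmul l X)"
proof
  assume "q X = q Y"
  moreover have "gtrans B \<eta> Y \<in> q Y"
    unfolding q_eq using zero_in_Lam gmul_simps(1) by force
  ultimately have "gtrans B \<eta> Y \<in> q X" by simp
  then obtain l where l: "l \<in> Lam" "gtrans B \<eta> Y = gtrans B \<eta> (gmul l X)"
    unfolding q_eq by auto
  then show "\<exists>l\<in>Lam. Y = gmul l X" using inj_gtrans by (metis injD)
next
  assume "\<exists>l\<in>Lam. Y = gmul l X"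
  then obtain l where l: "l \<in> Lam" "Y = gmul l X" by blast
  have "\<exists>m'. gmul m Y = gmul m' X \<and> m' \<in> Lam" if "m \<in> Lam" for m
    using l that gmul_in_Lam gmul_assoc by metis
  moreover have "\<exists>m'. gmul m X = gmul m' Y \<and> m' \<in> Lam" if "m \<in> Lam" for m
  proof (intro exI conjI)
    show "gmul m X = gmul (gmul m (- l)) Y" by (simp add: l(2) gmul_assoc)
    show "gmul m (- l) \<in> Lam" using that l(1) gmul_in_Lam uminus_in_Lam by blast
  qed
  ultimately have "{gmul l X | l. l \<in> Lam} = {gmul l Y | l. l \<in> Lam}" by blast
  then show "q X = q Y" by (simp add: q_eq)
qed

lemma q_gmul: "l \<in> Lam \<Longrightarrow> q (gmul l X) = q X"
  using q_eq_iff by metis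

lemma Lproj_image: "Lproj B \<eta> \<Gamma> ` gtrans B \<eta> ` U = q ` U"
  by (simp add: image_image q_def)

lemma topspace_Mtop: "topspace (Mtop B \<eta> \<Gamma>) = range q"
  by (simp add: Mtop_def topspace_quot_topology topspace_Ltop Lproj_image)

lemma openin_Mtop: "openin (Mtop B \<eta> \<Gamma>) U \<longleftrightarrow> U \<subseteq> range q \<and> open {X. q X \<in> U}"
proof -
  define W where "W = {g \<in> range (gtrans B \<eta>). Lproj B \<eta> \<Gamma> g \<in> U}"
  have W: "W = gtrans B \<eta> ` {X. q X \<in> U}" "{X. gtrans B \<eta> X \<in> W} = {X. q X \<in> U}"
    by (auto simp: W_def q_def)
  have "openin (Ltop B \<eta>) W \<longleftrightarrow> open {X. q X \<in> U}"
    using openin_Ltop_image[of "{X. q X \<in> U}"] openin_Ltop_vimage[of W] W by auto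
  then show ?thesis
    unfolding Mtop_def openin_quot_topology topspace_Ltop Lproj_image W_def by blast
qed

lemma open_translate: "open U \<Longrightarrow> open {X. gmul l X \<in> U}"
proof -
  assume "open U"
  have "continuous_on UNIV (gmul l)" by (intro continuous_intros)
  then have "open (gmul l -` U)" using \<open>open U\<close> by (simp add: open_vimage)
  then show ?thesis by (simp add: vimage_def)
qed

lemma openin_q_image:
  assumes "open U"
  shows "openin (Mtop B \<eta> \<Gamma>) (q ` U)"
proof -
  have "{X. q X \<in> q ` U} = (\<Union>l\<in>Lam. {X. gmul l X \<in> U})"
    by (auto simp: q_eq_iff image_iff)
  then show ?thesis
    unfolding openin_Mtop using assms open_translate by auto
qed

lemma continuous_map_q: "continuous_map euclidean (Mtop B \<eta> \<Gamma>) q"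
  unfolding continuous_map_def topspace_Mtop openin_Mtop by auto

lemma q_locally_injective: "\<exists>U. open U \<and> x \<in> U \<and> inj_on q U"
proof -
  obtain U where U: "open U" "x \<in> U" "\<forall>a\<in>U. \<forall>b\<in>U. gmul a (- b) \<in> Lam \<longrightarrow> a = b"
    using Lam_at_most_one_near by blast
  have "inj_on q U"
  proof (rule inj_onI)
    fix a b assume ab: "a \<in> U" "b \<in> U" "q a = q b"
    then obtain l where "l \<in> Lam" "b = gmul l a" using q_eq_iff by blast
    then have "gmul b (- a) \<in> Lam" by simp
    then show "a = b" using U(3) ab by blast
  qed
  then show ?thesis using U by blast
qed

text \<open>For points over \<open>x\<close> and \<open>y\<close> in different fibres,
  \<open>gmul y (- x)\<close> lies in the open complement of \<open>Lam\<close>. By continuity this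
  persists on neighbourhoods of \<open>x\<close> and \<open>y\<close>, whose images are therefore
  disjoint.\<close>

lemma Hausdorff_Mtop: "Hausdorff_space (Mtop B \<eta> \<Gamma>)"
  unfolding Hausdorff_space_def topspace_Mtop
proof (intro allI impI)
  fix a b assume ab: "a \<in> range q \<and> b \<in> range q \<and> a \<noteq> b"
  then obtain x y where xy: "a = q x" "b = q y" by blast
  have "gmul y (- x) \<notin> Lam"
  proof
    assume "gmul y (- x) \<in> Lam"
    then have "q x = q y" using q_gmul[of "gmul y (- x)" x] by simp
    then show False using ab xy by simp
  qed
  then obtain V W where VW: "open V" "open W" "y \<in> V" "x \<in> W"
    "\<forall>a\<in>V. \<forall>b\<in>W. gmul a (- b) \<in> - Lam"
    using gmul_uminus_neighbourhoods[of "- Lam" y x] closed_Lam by (auto simp: open_Compl)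
  have "disjnt (q ` W) (q ` V)"
  proof (unfold disjnt_iff, intro allI notI)
    fix p assume "p \<in> q ` W \<and> p \<in> q ` V"
    then obtain w v where "w \<in> W" "v \<in> V" "q w = q v" by force
    then obtain l where "l \<in> Lam" "v = gmul l w" using q_eq_iff by blast
    then have "gmul v (- w) \<in> Lam" by simp
    then show False using VW(5) \<open>w \<in> W\<close> \<open>v \<in> V\<close> by blast
  qed
  then show "\<exists>U V. openin (Mtop B \<eta> \<Gamma>) U \<and> openin (Mtop B \<eta> \<Gamma>) V \<and> a \<in> U \<and> b \<in> V \<and> disjnt U V"
    using VW xy openin_q_image by (intro exI[of _ "q ` W"] exI[of _ "q ` V"]) auto
qed

lemma second_countable_Mtop:
  "\<exists>\<B>. countable \<B> \<and> (\<forall>U\<in>\<B>. openin (Mtop B \<eta> \<Gamma>) U) \<and>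
     (\<forall>U p. openin (Mtop B \<eta> \<Gamma>) U \<and> p \<in> U \<longrightarrow> (\<exists>V\<in>\<B>. p \<in> V \<and> V \<subseteq> U))"
proof -
  obtain \<A> :: "'v set set" where \<A>: "countable \<A>" "topological_basis \<A>"
    using ex_countable_basis by blast
  show ?thesis
  proof (intro exI[of _ "(`) q ` \<A>"] conjI allI impI ballI)
    show "countable ((`) q ` \<A>)" using \<A>(1) by simp
    show "openin (Mtop B \<eta> \<Gamma>) U" if "U \<in> (`) q ` \<A>" for U
      using that openin_q_image \<A>(2) topological_basis_open by blast
    fix U p assume U: "openin (Mtop B \<eta> \<Gamma>) U \<and> p \<in> U"
    then obtain x where x: "p = q x" "open {X. q X \<in> U}" "q x \<in> U"
      unfolding openin_Mtop by blast
    then obtain A where "A \<in> \<A>" "x \<in> A" "A \<subseteq> {X. q X \<in> U}"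
      using topological_basisE[OF \<A>(2) x(2), of x] by blast
    then show "\<exists>V\<in>(`) q ` \<A>. p \<in> V \<and> V \<subseteq> U"
      using x(1) by (intro bexI[of _ "q ` A"]) auto
  qed
qed

section \<open>Charts of the quotient as local sections of the projection\<close>

lemma Matlas_cases:
  assumes "c \<in> Matlas B \<eta> \<Gamma>"
  obtains U where "open U" "inj_on q U" "fst c = q ` U" "\<And>u. u \<in> U \<Longrightarrow> snd c (q u) = u"
proof -
  obtain W where W: "openin (Ltop B \<eta>) W" "inj_on (Lproj B \<eta> \<Gamma>) W"
    and c: "c = (Lproj B \<eta> \<Gamma> ` W, (\<lambda>g. g 0) \<circ> inv_into W (Lproj B \<eta> \<Gamma>))"
    using assms unfolding Matlas_def quot_atlas_def orbit_chart_def by auto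
  define U where "U = {X. gtrans B \<eta> X \<in> W}"
  have W_eq: "W = gtrans B \<eta> ` U"
    using openin_subset[OF W(1)] unfolding topspace_Ltop U_def by blast
  have inv: "inv_into W (Lproj B \<eta> \<Gamma>) (q u) = gtrans B \<eta> u" if "u \<in> U" for u
    using inv_into_f_f[OF W(2), of "gtrans B \<eta> u"] that by (simp add: q_def U_def)
  show ?thesis
  proof (rule that[of U])
    show "open U" unfolding U_def using W(1) by (rule openin_Ltop_vimage)
    show "inj_on q U"
    proof (rule inj_onI)
      fix u v assume uv: "u \<in> U" "v \<in> U" "q u = q v"
      then have "gtrans B \<eta> u = gtrans B \<eta> v" using inv by metis
      then show "u = v" using inj_gtrans by (meson injD)
    qed
    show "fst c = q ` U" by (simp add: c W_eq Lproj_image)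
    show "snd c (q u) = u" if "u \<in> U" for u using inv[OF that] by (simp add: c)
  qed
qed

lemma
  assumes "c \<in> Matlas B \<eta> \<Gamma>"
  shows open_coordinates: "open (snd c ` fst c)"
    and fst_chart: "fst c = q ` (snd c ` fst c)"
    and snd_chart_q: "x \<in> snd c ` fst c \<Longrightarrow> snd c (q x) = x"
    and q_snd_chart: "p \<in> fst c \<Longrightarrow> q (snd c p) = p"
    and q_in_chart: "x \<in> snd c ` fst c \<Longrightarrow> q x \<in> fst c"
    and inv_chart: "x \<in> snd c ` fst c \<Longrightarrow> inv_into (fst c) (snd c) x = q x"
proof -
  obtain U where U: "open U" "inj_on q U" "fst c = q ` U" "\<And>u. u \<in> U \<Longrightarrow> snd c (q u) = u"
    using Matlas_cases[OF assms] by blast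
  have eq: "snd c ` fst c = U" using U(3,4) by (auto simp: image_image)
  show "open (snd c ` fst c)" "fst c = q ` (snd c ` fst c)"
    "x \<in> snd c ` fst c \<Longrightarrow> snd c (q x) = x"
    "p \<in> fst c \<Longrightarrow> q (snd c p) = p" "x \<in> snd c ` fst c \<Longrightarrow> q x \<in> fst c"
    using U(1,3,4) unfolding eq by auto
  have "inj_on (snd c) (q ` U)" using U(4) by (intro inj_onI) auto
  then show "inv_into (fst c) (snd c) x = q x" if "x \<in> snd c ` fst c"
    using that unfolding eq U(3) by (intro inv_into_f_eq) (auto simp: U(4))
qed

text \<open>The given \<open>x\<close> is itself a coordinate value of the chart, not merely some
  representative of \<open>q x\<close>, so lifts can be studied directly at
  \<open>x\<close>.\<close>

lemma chart_at:
  obtains c where "c \<in> Matlas B \<eta> \<Gamma>" "x \<in> snd c ` fst c"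
proof -
  obtain U where U: "open U" "x \<in> U" "inj_on q U" using q_locally_injective by blast
  define W where "W = gtrans B \<eta> ` U"
  have inj: "inj_on (Lproj B \<eta> \<Gamma>) W"
    unfolding W_def using U(3) by (auto simp: inj_on_def q_def)
  define c where "c = (Lproj B \<eta> \<Gamma> ` W, (\<lambda>g. g 0) \<circ> inv_into W (Lproj B \<eta> \<Gamma>))"
  have "c \<in> Matlas B \<eta> \<Gamma>"
    unfolding Matlas_def quot_atlas_def orbit_chart_def c_def
    using openin_Ltop_image[OF U(1)] inj by (auto simp: W_def carrier_Lgroup)
  moreover have "q x \<in> fst c" using U(2) by (simp add: c_def W_def Lproj_image)
  moreover have "snd c (q x) = x"
    using inv_into_f_f[OF inj, of "gtrans B \<eta> x"] U(2) by (simp add: c_def W_def q_def)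
  ultimately show ?thesis using that by (metis imageI)
qed

lemma chart_expr_M:
  "c \<in> Matlas B \<eta> \<Gamma> \<Longrightarrow> x \<in> snd c ` fst c \<Longrightarrow> chart_expr c d f x = snd d (f (q x))"
  by (simp add: chart_expr_def inv_chart)

lemma chart_dom_M:
  assumes "c \<in> Matlas B \<eta> \<Gamma>"
  shows "chart_dom c d f = {x \<in> snd c ` fst c. f (q x) \<in> fst d}"
  unfolding chart_dom_def using q_snd_chart[OF assms] q_in_chart[OF assms] snd_chart_q[OF assms]
  by force

text \<open>A chart selects one representative in each fibre. The lattice element leading to it at
  \<open>x\<close> still does so nearby, because the coordinate set is open.\<close>

lemma section_is_translation:
  assumes d: "d \<in> Matlas B \<eta> \<Gamma>" and x: "q x \<in> fst d"
  obtains l T where "l \<in> Lam" "open T" "x \<in> T"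
    "\<forall>y\<in>T. q y \<in> fst d \<and> snd d (q y) = gmul l y"
proof -
  obtain u where u: "u \<in> snd d ` fst d" "q x = q u" using q_snd_chart[OF d x] x by (metis imageI)
  then obtain l where l: "l \<in> Lam" "u = gmul l x" using q_eq_iff by blast
  define T where "T = {y. gmul l y \<in> snd d ` fst d}"
  show ?thesis
  proof (rule that[OF l(1), of T])
    show "open T" unfolding T_def by (rule open_translate[OF open_coordinates[OF d]])
    show "x \<in> T" using l u by (simp add: T_def)
    show "\<forall>y\<in>T. q y \<in> fst d \<and> snd d (q y) = gmul l y"
    proof
      fix y assume "y \<in> T"
      then have y: "gmul l y \<in> snd d ` fst d" by (simp add: T_def)
      have "q y = q (gmul l y)" using l(1) by (simp add: q_gmul)
      then show "q y \<in> fst d \<and> snd d (q y) = gmul l y"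
        using q_in_chart[OF d y] snd_chart_q[OF d y] by simp
    qed
  qed
qed

lemma linear_translation: "linear (\<lambda>u. u + e l u)"
  by (rule linearI) (simp_all add: e_simps algebra_simps)

text \<open>Changes of charts are left translations by lattice elements; this is why left-invariant
  fields descend to the quotient.\<close>

lemma transition_affine:
  assumes c: "c \<in> Matlas B \<eta> \<Gamma>" and d: "d \<in> Matlas B \<eta> \<Gamma>" and x: "x \<in> chart_dom c d id"
  obtains l T where "l \<in> Lam" "open T" "x \<in> T"
    "\<forall>y\<in>T. chart_expr c d id y = (y + e l y) + l"
    "chart_expr c d id x = gmul l x" "chart_diff c d id x = (\<lambda>u. u + e l u)"
proof -
  have x': "x \<in> snd c ` fst c" "q x \<in> fst d" using x by (auto simp: chart_dom_M[OF c])
  obtain l T where l: "l \<in> Lam" "open T" "x \<in> T"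
    "\<forall>y\<in>T. q y \<in> fst d \<and> snd d (q y) = gmul l y"
    by (rule section_is_translation[OF d x'(2)])
  define T' where "T' = T \<inter> snd c ` fst c"
  have T': "open T'" "x \<in> T'" using l x' open_coordinates[OF c] by (auto simp: T'_def)
  have expr: "chart_expr c d id y = (y + e l y) + l" if "y \<in> T'" for y
    using that l(4) by (simp add: T'_def chart_expr_M[OF c] gmul_def)
  show ?thesis
  proof (rule that[OF l(1) T'])
    show "\<forall>y\<in>T'. chart_expr c d id y = (y + e l y) + l" using expr by blast
    show "chart_expr c d id x = gmul l x" using expr[OF T'(2)] by (simp add: gmul_def)
    show "chart_diff c d id x = (\<lambda>u. u + e l u)"
      unfolding chart_diff_def
      by (rule affine_on_open_frechet_derivative[OF T' linear_translation expr])
  qed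
qed

lemma projection_affine:
  assumes d: "d \<in> Matlas B \<eta> \<Gamma>" and x: "x \<in> chart_dom (orbit_chart B \<eta>) d (Lproj B \<eta> \<Gamma>)"
  obtains l where
    "chart_expr (orbit_chart B \<eta>) d (Lproj B \<eta> \<Gamma>) x = gmul l x"
    "chart_diff (orbit_chart B \<eta>) d (Lproj B \<eta> \<Gamma>) x = (\<lambda>u. u + e l u)"
proof -
  have "q x \<in> fst d"
    using x by (auto simp: chart_dom_def orbit_chart_def carrier_Lgroup q_def)
  then obtain l T where l: "l \<in> Lam" "open T" "x \<in> T"
    "\<forall>y\<in>T. q y \<in> fst d \<and> snd d (q y) = gmul l y"
    by (rule section_is_translation[OF d])
  have expr: "chart_expr (orbit_chart B \<eta>) d (Lproj B \<eta> \<Gamma>) y = (y + e l y) + l" if "y \<in> T" for y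
    using l(4) that by (simp add: chart_expr_orbit_chart q_def gmul_def)
  show ?thesis
  proof (rule that)
    show "chart_expr (orbit_chart B \<eta>) d (Lproj B \<eta> \<Gamma>) x = gmul l x"
      using expr[OF l(3)] by (simp add: gmul_def)
    show "chart_diff (orbit_chart B \<eta>) d (Lproj B \<eta> \<Gamma>) x = (\<lambda>u. u + e l u)"
      unfolding chart_diff_def
      by (rule affine_on_open_frechet_derivative[OF l(2,3) linear_translation expr])
  qed
qed

lemma homeomorphic_map_chart:
  assumes c: "c \<in> Matlas B \<eta> \<Gamma>"
  shows "homeomorphic_map (subtopology (Mtop B \<eta> \<Gamma>) (fst c)) (top_of_set (snd c ` fst c)) (snd c)"
proof -
  define U where "U = snd c ` fst c"
  have U: "open U" "fst c = q ` U" "\<And>u. u \<in> U \<Longrightarrow> snd c (q u) = u"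
    using open_coordinates[OF c] fst_chart[OF c] snd_chart_q[OF c] by (auto simp: U_def)
  have top: "topspace (subtopology (Mtop B \<eta> \<Gamma>) (q ` U)) = q ` U"
    by (auto simp: topspace_Mtop)
  have "continuous_map (subtopology (Mtop B \<eta> \<Gamma>) (q ` U)) (top_of_set U) (snd c)"
    unfolding continuous_map_def top
  proof (intro conjI allI impI)
    show "snd c \<in> q ` U \<rightarrow> topspace (top_of_set U)" using U(3) by auto
    fix O' assume "openin (top_of_set U) O'"
    then have O': "open O'" "O' \<subseteq> U" using U(1) by (auto simp: openin_open_eq)
    then have "{p \<in> q ` U. snd c p \<in> O'} = q ` O'" using U(3) by force
    moreover have "openin (Mtop B \<eta> \<Gamma>) (q ` O')" using O'(1) by (rule openin_q_image)
    ultimately show "openin (subtopology (Mtop B \<eta> \<Gamma>) (q ` U)) {p \<in> q ` U. snd c p \<in> O'}"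
      unfolding openin_subtopology using O'(2) by (intro exI[of _ "q ` O'"]) auto
  qed
  moreover have "continuous_map (top_of_set U) (subtopology (Mtop B \<eta> \<Gamma>) (q ` U)) q"
    using continuous_map_q by (auto simp: continuous_map_in_subtopology intro: continuous_map_from_subtopology)
  ultimately have "homeomorphic_maps (subtopology (Mtop B \<eta> \<Gamma>) (q ` U)) (top_of_set U) (snd c) q"
    unfolding homeomorphic_maps_def top using U(3) by auto
  then have "homeomorphic_map (subtopology (Mtop B \<eta> \<Gamma>) (q ` U)) (top_of_set U) (snd c)"
    by (rule homeomorphic_maps_imp_map)
  then show ?thesis
    by (fold U_def) (simp add: U(2))
qed

lemma smooth_manifold_M: "smooth_manifold (Mtop B \<eta> \<Gamma>) (Matlas B \<eta> \<Gamma>)"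
  unfolding smooth_manifold_def
proof (intro conjI Hausdorff_Mtop second_countable_Mtop ballI)
  have "fst c \<subseteq> range q" if "c \<in> Matlas B \<eta> \<Gamma>" for c
    using fst_chart[OF that] by blast
  moreover have "\<exists>c\<in>Matlas B \<eta> \<Gamma>. q x \<in> fst c" for x
  proof -
    obtain c where "c \<in> Matlas B \<eta> \<Gamma>" "x \<in> snd c ` fst c" by (rule chart_at)
    then show ?thesis using fst_chart by blast
  qed
  ultimately show "\<Union> (fst ` Matlas B \<eta> \<Gamma>) = topspace (Mtop B \<eta> \<Gamma>)"
    unfolding topspace_Mtop by blast
next
  fix c assume c: "c \<in> Matlas B \<eta> \<Gamma>"
  show "case c of (U, \<phi>) \<Rightarrow> openin (Mtop B \<eta> \<Gamma>) U \<and> open (\<phi> ` U) \<and>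
    homeomorphic_map (subtopology (Mtop B \<eta> \<Gamma>) U) (top_of_set (\<phi> ` U)) \<phi>"
    using openin_q_image[OF open_coordinates[OF c]] fst_chart[OF c]
      open_coordinates[OF c] homeomorphic_map_chart[OF c] by (simp add: case_prod_beta)
  fix d assume d: "d \<in> Matlas B \<eta> \<Gamma>"
  show "smooth_on (chart_dom c d id) (chart_expr c d id)"
  proof (rule locally_affine_imp_smooth_on, unfold locally_affine_def, intro ballI)
    fix x assume "x \<in> chart_dom c d id"
    then obtain l T where "l \<in> Lam" "open T" "x \<in> T"
      "\<forall>y\<in>T. chart_expr c d id y = (y + e l y) + l"
      "chart_expr c d id x = gmul l x" "chart_diff c d id x = (\<lambda>u. u + e l u)"
      by (rule transition_affine[OF c d])
    then show "\<exists>T a b. open T \<and> x \<in> T \<and> linear a \<and> (\<forall>y\<in>T. chart_expr c d id y = a y + b)"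
      using linear_translation by blast
  qed
qed

end

section \<open>The nearly Kaehler structure and its automorphisms\<close>

locale nearly_kaehler_quotient = discrete_subgroup_L B \<eta> \<Gamma>
  for B :: "'v::euclidean_space \<Rightarrow> 'v \<Rightarrow> real" and \<eta> :: "'v \<Rightarrow> 'v \<Rightarrow> 'v \<Rightarrow> real"
    and \<Gamma> :: "('v \<Rightarrow> 'v) set" +
  fixes J :: "'v \<Rightarrow> 'v" and \<epsilon> :: real
  assumes so_J: "so_pred B J"
    and J_J: "J (J v) = \<epsilon> *\<^sub>R v"
    and \<epsilon>_nonzero: "\<epsilon> \<noteq> 0"
    and anticommute: "contr B \<eta> X (J Y) + J (contr B \<eta> X Y) = 0"
begin

lemma linear_J: "linear J" and J_skew: "B (J u) v = - B u (J v)"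
  using so_J unfolding so_pred_def by auto

lemmas J_simps = linear_add[OF linear_J] linear_diff[OF linear_J] linear_scale[OF linear_J]
  linear_neg[OF linear_J] linear_0[OF linear_J]

lemma J_e: "J (e X Y) = - e X (J Y)"
  using anticommute by (metis add.commute eq_neg_iff_add_eq_0)

text \<open>This is \<open>(1 + e X) J (1 - e X)\<close>, the left translate of \<open>J\<close> to
  \<open>X\<close>, simplified by anticommutation and the vanishing of products
  \<open>e X (e Y Z)\<close>.\<close>

definition Jf :: "'v \<Rightarrow> 'v \<Rightarrow> 'v" where
  "Jf X u = J u + 2 *\<^sub>R e X (J u)"

text \<open>Lattice translations preserve both fields, so their components are given by the same
  formula in every chart.\<close>

abbreviation hM :: "(('v \<Rightarrow> 'v) set, 'v) metric_field" where
  "hM \<equiv> \<lambda>c x. B"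

abbreviation JM :: "(('v \<Rightarrow> 'v) set, 'v) endo_field" where
  "JM \<equiv> \<lambda>c. Jf"

lemma Lendo_eq: "Lendo B \<eta> J c X u = Jf X u"
  unfolding Lendo_def inv_left_diff left_diff_eq Jf_def
  by (simp add: J_simps J_e e_simps scaleR_2)

lemma linear_Jf: "linear (Jf X)"
  unfolding Jf_def by (rule linearI) (simp_all add: J_simps e_simps algebra_simps)

lemma Jf_skew: "B (Jf X u) v = - B u (Jf X v)"
proof -
  have "B (e X (J u)) v = - B u (e X (J v))"
    using e_skew[of X "J u" v] J_skew[of u "e X v"] by (simp add: J_e B_simps)
  then show ?thesis by (simp add: Jf_def B_simps J_skew)
qed

lemma Jf_Jf: "Jf X (Jf X u) = \<epsilon> *\<^sub>R u"
  by (simp add: Jf_def J_simps e_simps J_e J_J)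

text \<open>The first-order terms cancel by skewness of \<open>e l\<close>; the quadratic term
  vanishes by isotropy of the support.\<close>

lemma translation_isometry: "B (u + e l u) (v + e l v) = B u v"
  using e_skew[of l u v] by (simp add: B_simps)

lemma Jf_translation: "Jf (gmul l X) (u + e l u) = Jf X u + e l (Jf X u)"
  by (simp add: Jf_def gmul_def J_simps e_simps J_e algebra_simps scaleR_2)

lemma induced: "induced_structure B \<eta> J \<Gamma> hM JM"
  unfolding induced_structure_def preserves_metric_def preserves_endo_def
proof (intro conjI ballI allI)
  fix c d x u v
  assume c: "c \<in> {orbit_chart B \<eta>}" and d: "d \<in> Matlas B \<eta> \<Gamma>"
    and "x \<in> chart_dom c d (Lproj B \<eta> \<Gamma>)"
  then obtain l where l: "chart_expr c d (Lproj B \<eta> \<Gamma>) x = gmul l x"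
    "chart_diff c d (Lproj B \<eta> \<Gamma>) x = (\<lambda>u. u + e l u)"
    using projection_affine[OF d, of x] by auto
  show "B (chart_diff c d (Lproj B \<eta> \<Gamma>) x u) (chart_diff c d (Lproj B \<eta> \<Gamma>) x v) = Lmetric B c x u v"
    by (simp add: l translation_isometry Lmetric_def)
  show "Jf (chart_expr c d (Lproj B \<eta> \<Gamma>) x) (chart_diff c d (Lproj B \<eta> \<Gamma>) x u) =
      chart_diff c d (Lproj B \<eta> \<Gamma>) x (Lendo B \<eta> J c x u)"
    by (simp add: l Lendo_eq Jf_translation)
qed

lemma pseudo_riemannian_M: "pseudo_riemannian (Matlas B \<eta> \<Gamma>) hM"
  unfolding pseudo_riemannian_def preserves_metric_def
proof (intro conjI ballI allI scalar_product)
  have "locally_affine S (\<lambda>x::'v. B u v)" for S u v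
    unfolding locally_affine_def
    by (intro ballI exI[of _ UNIV] exI[of _ "\<lambda>_. 0"] exI[of _ "B u v"]) (auto simp: linear_iff)
  then show "smooth_on S (\<lambda>x::'v. B u v)" for S u v
    by (rule locally_affine_imp_smooth_on)
  fix c d x u v assume "c \<in> Matlas B \<eta> \<Gamma>" "d \<in> Matlas B \<eta> \<Gamma>" "x \<in> chart_dom c d id"
  then obtain l T where "l \<in> Lam" "open T" "x \<in> T"
      "\<forall>y\<in>T. chart_expr c d id y = (y + e l y) + l"
      "chart_expr c d id x = gmul l x" "chart_diff c d id x = (\<lambda>u. u + e l u)"
    by (rule transition_affine)
  then show "B (chart_diff c d id x u) (chart_diff c d id x v) = B u v"
    by (simp add: translation_isometry)
qed

lemma linear_e_scaled: "linear (\<lambda>x. 2 *\<^sub>R e x v)"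
  by (rule linearI) (simp_all add: e_simps algebra_simps)

lemma endomorphism_field_M: "endomorphism_field (Matlas B \<eta> \<Gamma>) JM"
  unfolding endomorphism_field_def preserves_endo_def
proof (intro conjI ballI allI linear_Jf)
  have "locally_affine S (\<lambda>x. Jf x u)" for S u
    unfolding locally_affine_def Jf_def
    by (intro ballI exI[of _ UNIV] exI[of _ "\<lambda>x. 2 *\<^sub>R e x (J u)"] exI[of _ "J u"])
      (auto simp: linear_e_scaled)
  then show "smooth_on S (\<lambda>x. Jf x u)" for S u
    by (rule locally_affine_imp_smooth_on)
  fix c d x u assume "c \<in> Matlas B \<eta> \<Gamma>" "d \<in> Matlas B \<eta> \<Gamma>" "x \<in> chart_dom c d id"
  then obtain l T where "l \<in> Lam" "open T" "x \<in> T"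
      "\<forall>y\<in>T. chart_expr c d id y = (y + e l y) + l"
      "chart_expr c d id x = gmul l x" "chart_diff c d id x = (\<lambda>u. u + e l u)"
    by (rule transition_affine)
  then show "Jf (chart_expr c d id x) (chart_diff c d id x u) = chart_diff c d id x (Jf x u)"
    by (simp add: Jf_translation)
qed

lemma levi_civita_flat: "levi_civita S (\<lambda>x::'v. B) (\<lambda>x u v. 0)"
proof -
  have "locally_affine S (\<lambda>x::'v. 0::'v)"
    unfolding locally_affine_def
    by (intro ballI exI[of _ UNIV] exI[of _ "\<lambda>_. 0"] exI[of _ 0]) (auto simp: linear_iff)
  then have "smooth_on S (\<lambda>x::'v. 0::'v)" by (rule locally_affine_imp_smooth_on)
  then show ?thesis
    unfolding levi_civita_def by (simp add: bilinear_def linear_iff B_simps)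
qed

text \<open>The derivative in direction \<open>u\<close> is \<open>2 e u (J u)\<close>, which
  anticommutation turns into \<open>- 2 J (e u u)\<close>, and \<eta> is alternating.\<close>

lemma cov_deriv_endo_Jf: "cov_deriv_endo (\<lambda>x u v. 0) Jf x u u = 0"
proof -
  have "frechet_derivative (\<lambda>y. Jf y u) (at x) = (\<lambda>y. 2 *\<^sub>R e y (J u))"
    using affine_on_open_frechet_derivative[of UNIV x "\<lambda>y. 2 *\<^sub>R e y (J u)" "\<lambda>y. Jf y u" "J u"]
    by (simp add: linear_e_scaled Jf_def)
  moreover have "e u (J u) = 0"
    using J_e[of u u] by (simp add: e_same J_simps)
  ultimately show ?thesis
    by (simp add: cov_deriv_endo_def cov_deriv_def linear_0[OF linear_Jf])
qed

lemma nearly_kaehler_M: "nearly_kaehler \<epsilon> (Mtop B \<eta> \<Gamma>) (Matlas B \<eta> \<Gamma>) hM JM"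
  unfolding nearly_kaehler_def
  using smooth_manifold_M pseudo_riemannian_M endomorphism_field_M Jf_skew Jf_Jf
    levi_civita_flat cov_deriv_endo_Jf by blast

section \<open>Lifting automorphisms to affine maps of V\<close>

text \<open>In charts an automorphism is a smooth isometry of the constant metric \<open>B\<close>,
  hence locally affine.\<close>

lemma automorphism_local_lift:
  assumes f: "automorphism (Mtop B \<eta> \<Gamma>) (Matlas B \<eta> \<Gamma>) hM JM f"
  shows "\<exists>T a b. open T \<and> x \<in> T \<and> linear a \<and> (\<forall>y\<in>T. f (q y) = q (a y + b))"
proof -
  have bij: "bij_betw f (range q) (range q)"
    and cont: "continuous_map (Mtop B \<eta> \<Gamma>) (Mtop B \<eta> \<Gamma>) f"
    and smooth: "\<And>c d. c \<in> Matlas B \<eta> \<Gamma> \<Longrightarrow> d \<in> Matlas B \<eta> \<Gamma> \<Longrightarrow>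
      smooth_on (chart_dom c d f) (chart_expr c d f)"
    and iso: "\<And>c d x u v. c \<in> Matlas B \<eta> \<Gamma> \<Longrightarrow> d \<in> Matlas B \<eta> \<Gamma> \<Longrightarrow> x \<in> chart_dom c d f \<Longrightarrow>
      B (chart_diff c d f x u) (chart_diff c d f x v) = B u v"
    using f unfolding automorphism_def smooth_map_def preserves_metric_def topspace_Mtop by auto
  obtain c where c: "c \<in> Matlas B \<eta> \<Gamma>" "x \<in> snd c ` fst c" by (rule chart_at)
  obtain x' where x': "f (q x) = q x'" using bij_betwE[OF bij] by blast
  obtain d where d: "d \<in> Matlas B \<eta> \<Gamma>" "x' \<in> snd d ` fst d" by (rule chart_at)
  define D where "D = chart_dom c d f"
  have D: "D = {x \<in> snd c ` fst c. f (q x) \<in> fst d}"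
    unfolding D_def using c(1) by (rule chart_dom_M)
  have "openin (Mtop B \<eta> \<Gamma>) (fst d)"
    using openin_q_image[OF open_coordinates[OF d(1)]] fst_chart[OF d(1)] by simp
  then have "openin (Mtop B \<eta> \<Gamma>) {p \<in> topspace (Mtop B \<eta> \<Gamma>). f p \<in> fst d}"
    by (rule openin_continuous_map_preimage[OF cont])
  then have "open {X. f (q X) \<in> fst d}"
    unfolding openin_Mtop topspace_Mtop by simp
  then have "open (snd c ` fst c \<inter> {X. f (q X) \<in> fst d})"
    using open_coordinates[OF c(1)] by (rule open_Int[rotated])
  moreover have "D = snd c ` fst c \<inter> {X. f (q X) \<in> fst d}" unfolding D by blast
  ultimately have openD: "open D" by simp
  have xD: "x \<in> D" unfolding D using c(2) x' q_in_chart[OF d] by simp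
  have "locally_affine D (chart_expr c d f)"
  proof (rule isometric_Ck_2_imp_locally_affine[OF scalar_product openD])
    show "Ck_on (Suc (Suc 0)) D (chart_expr c d f)"
      using smooth[OF c(1) d(1)] unfolding smooth_on_def D_def by blast
    show "B (frechet_derivative (chart_expr c d f) (at x) u)
        (frechet_derivative (chart_expr c d f) (at x) v) = B u v" if "x \<in> D" for x u v
      using iso[OF c(1) d(1)] that unfolding chart_diff_def D_def by blast
  qed
  then obtain T a b where T: "open T" "x \<in> T" "linear a" "\<forall>y\<in>T. chart_expr c d f y = a y + b"
    using xD unfolding locally_affine_def by blast
  have "f (q y) = q (a y + b)" if "y \<in> T \<inter> D" for y
  proof -
    have y: "y \<in> snd c ` fst c" "f (q y) \<in> fst d" using that unfolding D by auto
    then have "a y + b = snd d (f (q y))"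
      using T(4) that chart_expr_M[OF c(1) y(1), of d f] by simp
    then show ?thesis using q_snd_chart[OF d(1) y(2)] by simp
  qed
  then show ?thesis
    using T openD xD by (intro exI[of _ "T \<inter> D"] exI[of _ a] exI[of _ b]) auto
qed

text \<open>Where the two lifts agree modulo the lattice, discreteness makes them differ by one
  fixed lattice element near \<open>y0\<close>. This is an identity between affine maps, so it
  extends from an open set to V.\<close>

lemma affine_lift_unique:
  fixes a a' :: "'v \<Rightarrow> 'v"
  assumes N: "open N" "y0 \<in> N" and lin: "linear a" "linear a'"
    and eq: "\<And>y. y \<in> N \<Longrightarrow> q (a y + b) = q (a' y + b')"
  shows "q (a y + b) = q (a' y + b')"
proof -
  obtain l where l: "l \<in> Lam" "a' y0 + b' = gmul l (a y0 + b)"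
    using eq[OF N(2)] q_eq_iff by blast
  obtain U where U: "open U" "a' y0 + b' \<in> U" "\<forall>v\<in>U. \<forall>w\<in>U. gmul v (- w) \<in> Lam \<longrightarrow> v = w"
    using Lam_at_most_one_near by blast
  \<comment> \<open>On \<open>N'\<close> both \<open>a' y + b'\<close> and
    \<open>gmul l (a y + b)\<close> lie in \<open>U\<close>, where points differing by a lattice
    element are equal.\<close>
  define N' where "N' = N \<inter> (\<lambda>y. a' y + b') -` U \<inter> (\<lambda>y. gmul l (a y + b)) -` U"
  have cont: "continuous_on UNIV a" "continuous_on UNIV a'"
    using lin by (auto intro!: linear_continuous_on simp: linear_conv_bounded_linear)
  have "open N'"
    unfolding N'_def using N(1) U(1) cont by (intro open_Int open_vimage continuous_intros)
  have "y0 \<in> N'" using N(2) U(2) l(2) by (simp add: N'_def)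
  have eq': "a' y + b' = (a y + e l (a y)) + gmul l b" if "y \<in> N'" for y
  proof -
    have y: "y \<in> N" "a' y + b' \<in> U" "gmul l (a y + b) \<in> U" using that by (auto simp: N'_def)
    obtain m where m: "m \<in> Lam" "a' y + b' = gmul m (a y + b)"
      using eq[OF y(1)] q_eq_iff by blast
    \<comment> \<open>The lattice element \<open>m\<close> depends on \<open>y\<close>. Its quotient
      by the fixed \<open>l\<close> is independent of \<open>w\<close> and lies in the lattice, so
      the choice of \<open>U\<close> applies.\<close>
    have "gmul (gmul m w) (- gmul l w) = gmul m (- l)" for w
      unfolding uminus_gmul gmul_assoc[symmetric] by simp
    then have "gmul (a' y + b') (- gmul l (a y + b)) = gmul m (- l)" by (simp only: m(2))
    also have "\<dots> \<in> Lam" using m(1) l(1) gmul_in_Lam uminus_in_Lam by blast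
    finally have "a' y + b' = gmul l (a y + b)" using U(3) y by blast
    then show ?thesis by (simp add: gmul_def e_simps)
  qed
  have lin': "linear (\<lambda>y. a y + e l (a y))"
    using linear_compose[OF lin(1) linear_translation] by (simp add: o_def)
  \<comment> \<open>Comparing derivatives at \<open>y0\<close> gives the linear parts as maps on all
    of V; the constants then follow.\<close>
  have "frechet_derivative (\<lambda>y. a' y + b') (at y0) = a'"
    by (rule affine_on_open_frechet_derivative[of UNIV _ _ _ b']) (auto simp: lin)
  moreover have "frechet_derivative (\<lambda>y. a' y + b') (at y0) = (\<lambda>y. a y + e l (a y))"
    using affine_on_open_frechet_derivative[OF \<open>open N'\<close> \<open>y0 \<in> N'\<close> lin' eq'] by simp
  ultimately have a': "a' = (\<lambda>y. a y + e l (a y))" by simp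
  then have "b' = gmul l b" using eq'[OF \<open>y0 \<in> N'\<close>] by simp
  then have "a' y + b' = gmul l (a y + b)"
    by (simp add: a' gmul_def e_simps)
  then show ?thesis using q_gmul[OF l(1)] by simp
qed

text \<open>The affine lift near 0 is continued over the connected space V: the set of points near
  which it lifts \<open>f\<close> is open, closed and non-empty.\<close>

lemma automorphism_lift:
  assumes f: "automorphism (Mtop B \<eta> \<Gamma>) (Matlas B \<eta> \<Gamma>) hM JM f"
  obtains a b where "linear a" "\<And>z. f (q z) = q (a z + b)"
    "\<And>u v. B (a u) (a v) = B u v" "\<And>z u. Jf (a z + b) (a u) = a (Jf z u)"
proof -
  obtain T a b where T: "open T" "0 \<in> T" "linear a" "\<forall>y\<in>T. f (q y) = q (a y + b)"
    using automorphism_local_lift[OF f, of 0] by (elim exE conjE) (rule that)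
  define S where "S = {z. \<exists>T. open T \<and> z \<in> T \<and> (\<forall>y\<in>T. f (q y) = q (a y + b))}"
  have "S = \<Union>{T. open T \<and> (\<forall>y\<in>T. f (q y) = q (a y + b))}"
    unfolding S_def by auto
  then have "open S" by auto
  moreover have "closed S"
    unfolding closed_limpt
  proof (intro allI impI)
    fix z assume "z islimpt S"
    obtain T' a' b' where T': "open T'" "z \<in> T'" "linear a'" "\<forall>y\<in>T'. f (q y) = q (a' y + b')"
      using automorphism_local_lift[OF f, of z] by (elim exE conjE) (rule that)
    \<comment> \<open>Near \<open>y0\<close> both the global candidate and the local lift at
      \<open>z\<close> represent \<open>f\<close>, so uniqueness makes them agree modulo the lattice
      everywhere.\<close>
    obtain y0 where y0: "y0 \<in> S" "y0 \<in> T'" using \<open>z islimpt S\<close> T'(1,2) by (meson islimptE)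
    then obtain T0 where T0: "open T0" "y0 \<in> T0" "\<forall>y\<in>T0. f (q y) = q (a y + b)"
      unfolding S_def by blast
    have "q (a y + b) = q (a' y + b')" for y
    proof (rule affine_lift_unique[of "T0 \<inter> T'" y0 a a'])
      show "open (T0 \<inter> T')" "y0 \<in> T0 \<inter> T'" using T0 T' y0 by auto
      show "q (a y + b) = q (a' y + b')" if "y \<in> T0 \<inter> T'" for y
        using that T0(3) T'(4) by fastforce
    qed (rule T(3), rule T'(3))
    then show "z \<in> S" unfolding S_def using T' by auto
  qed
  moreover have "0 \<in> S" unfolding S_def using T by blast
  ultimately have "S = UNIV" using clopen[of S] by blast
  have lift: "f (q z) = q (a z + b)" for z
  proof -
    have "z \<in> S" using \<open>S = UNIV\<close> by simp
    then show ?thesis unfolding S_def by auto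
  qed
  have pres: "B (a u) (a v) = B u v \<and> Jf (a z + b) (a u) = a (Jf z u)" for u v z
  proof -
    obtain c where c: "c \<in> Matlas B \<eta> \<Gamma>" "z \<in> snd c ` fst c" by (rule chart_at)
    obtain d where d: "d \<in> Matlas B \<eta> \<Gamma>" "a z + b \<in> snd d ` fst d" by (rule chart_at)
    \<comment> \<open>With charts around \<open>z\<close> and its image \<open>a z + b\<close>, the
      expression of \<open>f\<close> near \<open>z\<close> is the lift itself, so its differential
      is \<open>a\<close>.\<close>
    define N where "N = snd c ` fst c \<inter> (\<lambda>y. a y + b) -` (snd d ` fst d)"
    have "continuous_on UNIV a"
      using T(3) by (auto intro!: linear_continuous_on simp: linear_conv_bounded_linear)
    then have N: "open N" "z \<in> N"
      unfolding N_def using c d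
      by (auto intro!: open_Int open_vimage continuous_intros open_coordinates)
    have expr: "chart_expr c d f y = a y + b" if "y \<in> N" for y
      using that chart_expr_M[OF c(1), of y d f] snd_chart_q[OF d(1), of "a y + b"]
      by (simp add: N_def lift)
    have diff: "chart_diff c d f z = a"
      unfolding chart_diff_def by (rule affine_on_open_frechet_derivative[OF N T(3) expr])
    have dom: "z \<in> chart_dom c d f"
      using c d q_in_chart[OF d] by (simp add: chart_dom_M[OF c(1)] lift)
    have "B (chart_diff c d f z u) (chart_diff c d f z v) = B u v"
      "Jf (chart_expr c d f z) (chart_diff c d f z u) = chart_diff c d f z (Jf z u)"
      using f c(1) d(1) dom
      unfolding automorphism_def preserves_metric_def preserves_endo_def by blast+
    then show ?thesis by (simp add: diff expr[OF N(2)])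
  qed
  show ?thesis
    by (rule that[OF T(3)]) (use lift pres in auto)
qed

end

section \<open>Inhomogeneity\<close>

context discrete_subgroup_L begin

text \<open>The images of balls around 0 form an increasing open cover of the quotient, so one ball
  suffices by compactness.\<close>

lemma bounded_representatives:
  assumes "compact_space (Mtop B \<eta> \<Gamma>)"
  obtains N where "\<And>X. \<exists>l\<in>Lam. norm (gmul l X) < N"
proof -
  define \<U> where "\<U> = range (\<lambda>n::nat. q ` ball 0 (real n))"
  have cover: "topspace (Mtop B \<eta> \<Gamma>) \<subseteq> \<Union>\<U>"
  proof (unfold topspace_Mtop, rule subsetI)
    fix p assume "p \<in> range q"
    then obtain X where X: "p = q X" by blast
    obtain n :: nat where "norm X < real n" using reals_Archimedean2 by blast
    then have "q X \<in> q ` ball 0 (real n)" by simp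
    then show "p \<in> \<Union>\<U>" unfolding \<U>_def X by blast
  qed
  have "\<forall>U\<in>\<U>. openin (Mtop B \<eta> \<Gamma>) U"
    unfolding \<U>_def using openin_q_image by auto
  then obtain \<F> where F: "finite \<F>" "\<F> \<subseteq> \<U>" "topspace (Mtop B \<eta> \<Gamma>) \<subseteq> \<Union>\<F>"
    using assms cover unfolding compact_space_def compactin_def by meson
  then obtain I where I: "finite I" "\<F> = (\<lambda>n. q ` ball 0 (real n)) ` I"
    unfolding \<U>_def by (meson finite_subset_image)
  obtain N where N: "\<And>n. n \<in> I \<Longrightarrow> n \<le> N"
    using I(1) finite_nat_set_iff_bounded_le by auto
  show ?thesis
  proof (rule that)
    fix X
    have "q X \<in> \<Union>\<F>" using F(3) unfolding topspace_Mtop by blast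
    then obtain n Y where nY: "n \<in> I" "norm Y < real n" "q X = q Y"
      unfolding I(2) by auto
    then obtain l where "l \<in> Lam" "Y = gmul l X" using q_eq_iff by blast
    moreover have "norm Y < real N" using nY(2) N[OF nY(1)] by simp
    ultimately show "\<exists>l\<in>Lam. norm (gmul l X) < real N" by blast
  qed
qed

text \<open>A linear form vanishing on the lattice and on the support is invariant under left
  translations by the lattice. By co-compactness it is then bounded above on V, hence zero.\<close>

lemma span_lattice_and_support:
  assumes "compact_space (Mtop B \<eta> \<Gamma>)"
  shows "span (Lam \<union> supp3 B \<eta>) = UNIV"
proof (rule ccontr)
  assume "span (Lam \<union> supp3 B \<eta>) \<noteq> UNIV"
  then obtain a where a: "a \<noteq> 0" "\<forall>x\<in>span (Lam \<union> supp3 B \<eta>). a \<bullet> x = 0"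
    using span_not_UNIV_orthogonal by blast
  obtain N where N: "\<And>X. \<exists>l\<in>Lam. norm (gmul l X) < N"
    using bounded_representatives[OF assms] by blast
  have bound: "a \<bullet> X \<le> norm a * N" for X
  proof -
    obtain l where l: "l \<in> Lam" "norm (gmul l X) < N" using N by blast
    have "a \<bullet> l = 0" "a \<bullet> e l X = 0"
      using a(2) l(1) e_in_supp3 by (auto simp: span_base)
    then have "a \<bullet> X = a \<bullet> gmul l X" by (simp add: gmul_def inner_add_right)
    also have "\<dots> \<le> norm a * norm (gmul l X)" by (rule norm_cauchy_schwarz)
    also have "\<dots> \<le> norm a * N" using l(2) by (intro mult_left_mono) auto
    finally show ?thesis .
  qed
  have pos: "a \<bullet> a > 0" using a(1) by simp
  have "a \<bullet> (((norm a * N + 1) / (a \<bullet> a)) *\<^sub>R a) = norm a * N + 1"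
    using pos by simp
  then show False using bound[of "((norm a * N + 1) / (a \<bullet> a)) *\<^sub>R a"] by simp
qed

end

section \<open>Geodesic loops and the countability argument\<close>

lemma countable_affine_range_imp_zero:
  fixes c m :: real
  assumes "countable (range (\<lambda>t. c + t * m))"
  shows "m = 0"
proof (rule ccontr)
  assume "m \<noteq> 0"
  then have "inj (\<lambda>t. c + t * m)" by (intro injI) simp
  then have "countable (UNIV :: real set)"
    using assms countable_image_inj_on by blast
  then show False using uncountable_UNIV_real by blast
qed

context nearly_kaehler_quotient begin

text \<open>
  \<open>loop X l\<close> is the vector of the geodesic loop at \<open>q X\<close> that lifts to the segment from
  \<open>X\<close> to \<open>gmul l X\<close>. Automorphisms map these loops to such loops.
\<close>

definition loop :: "'v \<Rightarrow> 'v \<Rightarrow> 'v" where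
  "loop X l = gmul l X - X"

text \<open>Loop vectors are \<open>k - e X k\<close>. Of the factor 4, three units come from the
  second argument \<open>J m + 3 e X (J m)\<close> and one from the first; the term quadratic in
  \<open>X\<close> vanishes by isotropy.\<close>

lemma loop_pairing: "B (loop X l) (Jf X (loop X m)) = B l (J m) - 4 * \<eta> X l (J m)"
proof -
  have "loop X k = k - e X k" for k
    by (simp add: loop_def gmul_def e_swap[of k X])
  moreover have "3 *\<^sub>R w = w + 2 *\<^sub>R w" for w :: 'v
    using scaleR_left_distrib[of 1 2 w] by simp
  ultimately have "B (loop X l) (Jf X (loop X m)) = B (l - e X l) (J m + 3 *\<^sub>R e X (J m))"
    by (simp add: Jf_def J_simps J_e e_simps add.assoc)
  also have "\<dots> = B l (J m) + 3 * B l (e X (J m)) - B (e X l) (J m)"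
    by (simp add: B_simps)
  also have "\<dots> = B l (J m) - 4 * \<eta> X l (J m)"
    by (simp add: B_e B_e_right form_swap(1)[where x = X and y = l and z = "J m"])
  finally show ?thesis .
qed

text \<open>Automorphisms preserve the pairings of loop vectors. If every point can be moved to
  \<open>q 0\<close>, the pairing, affine in \<open>X\<close>, takes values in a countable set, so
  its slope vanishes.\<close>

lemma homogeneous_imp_form_zero:
  assumes hom: "admits_transitive_automorphism_group (Mtop B \<eta> \<Gamma>) (Matlas B \<eta> \<Gamma>) hM JM"
    and l: "l \<in> Lam" and m: "m \<in> Lam"
  shows "\<eta> X l (J m) = 0"
proof -
  \<comment> \<open>All pairings at points over \<open>q 0\<close>. A lift may carry
    \<open>Y\<close> to any lattice point \<open>n\<close>, not just to 0, so \<open>n\<close>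
    varies too.\<close>
  define C where "C = (\<lambda>(n, l', m'). B l' (J m') - 4 * \<eta> n l' (J m')) ` (Lam \<times> Lam \<times> Lam)"
  have "countable C"
    unfolding C_def using countable_Lam by (intro countable_image countable_SIGMA) auto
  have in_C: "B l (J m) - 4 * \<eta> Y l (J m) \<in> C" for Y
  proof -
    obtain f where f: "automorphism (Mtop B \<eta> \<Gamma>) (Matlas B \<eta> \<Gamma>) hM JM f" "f (q Y) = q 0"
      using hom unfolding admits_transitive_automorphism_group_def topspace_Mtop by blast
    obtain a b where ab: "linear a" "\<And>z. f (q z) = q (a z + b)"
      "\<And>u v. B (a u) (a v) = B u v" "\<And>z u. Jf (a z + b) (a u) = a (Jf z u)"
      using automorphism_lift[OF f(1)] by metis
    define n where "n = a Y + b"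
    have "q 0 = q n" using f(2) ab(2) by (simp add: n_def)
    then have n: "n \<in> Lam" using q_eq_iff[of 0 n] by auto
    \<comment> \<open>The ends \<open>Y\<close> and \<open>gmul k Y\<close> of the segment have the
      same projection; hence so do their images under the lift.\<close>
    have "\<exists>k'\<in>Lam. a (loop Y k) = loop n k'" if "k \<in> Lam" for k
    proof -
      have "q (a (gmul k Y) + b) = q n"
        using ab(2)[of "gmul k Y"] ab(2)[of Y] q_gmul[OF that] by (simp add: n_def)
      then obtain k' where k': "k' \<in> Lam" "a (gmul k Y) + b = gmul k' n"
        using q_eq_iff by metis
      have "a (loop Y k) = a (gmul k Y) - a Y"
        unfolding loop_def by (rule linear_diff[OF ab(1)])
      also have "\<dots> = loop n k'"
        using k'(2) by (simp add: loop_def n_def algebra_simps)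
      finally show ?thesis using k'(1) by blast
    qed
    then obtain l' m' where lm: "l' \<in> Lam" "m' \<in> Lam" "a (loop Y l) = loop n l'" "a (loop Y m) = loop n m'"
      using l m by metis
    have "B l (J m) - 4 * \<eta> Y l (J m) = B (a (loop Y l)) (a (Jf Y (loop Y m)))"
      by (simp add: ab(3) loop_pairing)
    also have "\<dots> = B (loop n l') (Jf n (loop n m'))"
      using ab(4)[of Y "loop Y m"] lm by (simp add: n_def)
    also have "\<dots> = B l' (J m') - 4 * \<eta> n l' (J m')"
      by (rule loop_pairing)
    finally show ?thesis
      unfolding C_def using lm(1,2) n by (intro image_eqI[of _ _ "(n, l', m')"]) auto
  qed
  have "range (\<lambda>t. B l (J m) + t * (- 4 * \<eta> X l (J m))) \<subseteq> C"
    using in_C[of "_ *\<^sub>R X"] linear_scale[OF linear_form(1)] by (auto simp: algebra_simps)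
  then have "countable (range (\<lambda>t. B l (J m) + t * (- 4 * \<eta> X l (J m))))"
    using \<open>countable C\<close> countable_subset by blast
  then have "- 4 * \<eta> X l (J m) = 0" by (rule countable_affine_range_imp_zero)
  then show ?thesis by simp
qed

theorem inhomogeneous:
  assumes nonzero: "\<eta> x y z \<noteq> 0" and compact: "compact_space (Mtop B \<eta> \<Gamma>)"
  shows "\<not> admits_transitive_automorphism_group (Mtop B \<eta> \<Gamma>) (Matlas B \<eta> \<Gamma>) hM JM"
proof
  assume hom: "admits_transitive_automorphism_group (Mtop B \<eta> \<Gamma>) (Matlas B \<eta> \<Gamma>) hM JM"
  note spanning = span_lattice_and_support[OF compact]
  \<comment> \<open>Support vectors are annihilated by \<eta>, also after applying \<open>J\<close>;
    this covers the part of V that the lattice may fail to span.\<close>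
  have supp: "\<eta> X s Y = 0" "\<eta> X Y (J s) = 0" if "s \<in> supp3 B \<eta>" for X Y s
  proof -
    have "e X s = 0" using that by (rule e_supp3)
    then show "\<eta> X s Y = 0" using B_e[of X s Y] by (simp add: B_simps)
    have "B (e X (J Y)) s = 0" using e_skew[of X "J Y" s] \<open>e X s = 0\<close> by (simp add: B_simps)
    then show "\<eta> X Y (J s) = 0"
      using B_e[of X Y "J s"] J_skew[of "e X Y" s] by (simp add: J_e B_simps)
  qed
  have vanish: "\<eta> X l (J Y) = 0" if "l \<in> Lam" for X Y l
  proof -
    have "linear (\<lambda>Y. \<eta> X l (J Y))"
      using linear_compose[OF linear_J linear_form(3)] by (simp add: o_def)
    from linear_eq_on_span[OF this linear_zero, of "Lam \<union> supp3 B \<eta>" Y]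
    show ?thesis
      using homogeneous_imp_form_zero[OF hom that] supp(2) spanning by blast
  qed
  have "\<eta> X Y (J Z) = 0" for X Y Z
  proof -
    from linear_eq_on_span[OF linear_form(2) linear_zero, of "Lam \<union> supp3 B \<eta>" X "J Z" Y]
    show ?thesis using vanish supp(1) spanning by blast
  qed
  \<comment> \<open>Substituting \<open>J z\<close> turns \<open>J (J z)\<close> into a non-zero
    multiple of \<open>z\<close>.\<close>
  from this[of x y "J z"] have "\<epsilon> * \<eta> x y z = 0"
    by (simp add: J_J linear_scale[OF linear_form(3)])
  then show False using nonzero \<epsilon>_nonzero by simp
qed

end

section \<open>Existence of lattices\<close>

text \<open>The reals are viewed as a vector space over the rationals, and the assignment of 1 to
  the independent vector 1 is extended linearly.\<close>

lemma rational_projection: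
  obtains p :: "real \<Rightarrow> real" where "\<And>x y. p (x + y) = p x + p y"
    "\<And>r x. r \<in> \<rat> \<Longrightarrow> p (r * x) = r * p x" "\<And>x. p x \<in> \<rat>" "p 1 = 1"
proof -
  interpret vector_space_pair "\<lambda>r x. real_of_rat r * x" "(*) :: rat \<Rightarrow> rat \<Rightarrow> rat"
    by unfold_locales (simp_all add: algebra_simps of_rat_add of_rat_mult)
  have "\<not> vs1.dependent {1}" by simp
  from linear_independent_extend[OF this, of "\<lambda>_. 1"]
  obtain g where g: "Vector_Spaces.linear (\<lambda>r x. real_of_rat r * x) (*) g" "g 1 = 1" by auto
  show ?thesis
  proof (rule that[of "\<lambda>x. of_rat (g x)"])
    fix r x :: real assume "r \<in> \<rat>"
    then obtain s where "r = of_rat s" by (auto elim: Rats_cases)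
    then show "of_rat (g (r * x)) = r * of_rat (g x)"
      using linear_scale[OF g(1), of s x] by (simp add: of_rat_mult)
  qed (simp_all add: linear_add[OF g(1)] of_rat_add g(2))
qed

lemma common_denominator:
  fixes A :: "real set"
  assumes "finite A" "A \<subseteq> \<rat>"
  shows "\<exists>N::nat. N > 0 \<and> (\<forall>r\<in>A. real N * r \<in> \<int>)"
  using assms
proof (induction rule: finite_induct)
  case empty
  then show ?case by (intro exI[of _ 1]) simp
next
  case (insert r A)
  then obtain N :: nat where N: "N > 0" "\<forall>r\<in>A. real N * r \<in> \<int>" by auto
  have "r \<in> \<rat>" using insert.prems by simp
  then obtain i :: int and n :: nat where n: "n > 0" "r = of_int i / of_nat n"
    unfolding Rats_eq_int_div_nat by auto
  have "real (N * n) * r = real N * of_int i" using n by simp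
  then have "real (N * n) * r \<in> \<int>" by (metis Ints_mult Ints_of_int Ints_of_nat)
  moreover have "real (N * n) * s \<in> \<int>" if "s \<in> A" for s
  proof -
    have "real (N * n) * s = real n * (real N * s)" by simp
    then show ?thesis using N(2) that by (metis Ints_mult Ints_of_nat)
  qed
  ultimately show ?case using N(1) n(1) by (intro exI[of _ "N * n"]) auto
qed

section \<open>Rational structure constants and the construction of a lattice\<close>

context isotropic_three_form begin

text \<open>
  The coordinates \<open>r\<^sub>d\<close> of \<open>e f g\<close> in \<open>D\<close> solve a linear system with rational
  coefficients. A rational-linear projection \<open>\<real> \<rightarrow> \<rat>\<close> maps this solution to a rational one,
  which is the same by uniqueness.
\<close>

lemma rational_adapted_basis:
  assumes E: "span E = UNIV" and rat: "rational_coefficients \<eta> E"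
  obtains D F where "independent F" "span F = UNIV" "D \<subseteq> F"
    "\<And>d X. d \<in> D \<Longrightarrow> e d X = 0" "\<And>X Y. e X Y \<in> span D"
    "\<And>f g h. f \<in> F \<Longrightarrow> g \<in> F \<Longrightarrow> real_vector.representation F (e f g) h \<in> \<rat>"
proof -
  define S where "S = (\<lambda>(x, y). e x y) ` (E \<times> E)"
  obtain D where D: "D \<subseteq> S" "independent D" "S \<subseteq> span D"
    using maximal_independent_subset by blast
  \<comment> \<open>Each vector of \<open>F\<close> lies in \<open>D\<close>, where \<open>e\<close>
    vanishes, or in \<open>E\<close>, where the coefficients of \<eta> are rational.\<close>
  obtain F where F: "D \<subseteq> F" "F \<subseteq> D \<union> E" "independent F" "D \<union> E \<subseteq> span F"
    using maximal_independent_subset_extend[of D "D \<union> E"] D(2) by auto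
  have spanF: "span F = UNIV"
    using E F(4) span_mono[of E "span F"] by (auto simp: span_span)
  have e_D: "e d X = 0" "e X d = 0" if "d \<in> D" for d X
    using that D(1) by (auto simp: S_def)
  have e_spanD: "e X Y \<in> span D" for X Y
  proof -
    have 1: "e x Y \<in> span D" if "x \<in> E" for x Y
    proof -
      have "Y \<in> span E" using E by simp
      then show ?thesis
      proof (induction rule: span_induct_alt)
        case base then show ?case by (simp add: e_simps span_zero)
      next
        case (step c y z)
        have "e x y \<in> span D" using D(3) that step(1) by (auto simp: S_def)
        then show ?case using step(2) by (simp add: e_simps span_add span_scale)
      qed
    qed
    have "X \<in> span E" using E by simp
    then show ?thesis
    proof (induction rule: span_induct_alt)
      case base then show ?case by (simp add: e_simps span_zero)
    next
      case (step c x z)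
      then show ?case using 1[OF step(1)] by (simp add: e_simps span_add span_scale)
    qed
  qed
  have finF: "finite F" using F(3) independent_bound by blast
  obtain p :: "real \<Rightarrow> real" where p: "\<And>x y. p (x + y) = p x + p y"
    "\<And>r x. r \<in> \<rat> \<Longrightarrow> p (r * x) = r * p x" "\<And>x. p x \<in> \<rat>" "p 1 = 1"
    using rational_projection by blast
  have p_sum: "p (\<Sum>i\<in>I. u i) = (\<Sum>i\<in>I. p (u i))" for I :: "'v set" and u
    using p(1) p(2)[of 0 0] by (induction I rule: infinite_finite_induct) auto
  have p_rat: "p r = r" if "r \<in> \<rat>" for r
    using p(2)[OF that, of 1] p(4) by simp
  have "real_vector.representation F (e f g) h \<in> \<rat>" if f: "f \<in> E" and g: "g \<in> E" for f g h
  proof -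
    define r where "r = real_vector.representation F (e f g)"
    have r_D: "r d = 0" if "d \<notin> D" for d
      using real_vector.representation_extend[OF F(3) e_spanD F(1)] that real_vector.representation_ne_zero
      unfolding r_def by metis
    have efg: "e f g = (\<Sum>d\<in>F. r d *\<^sub>R d)"
      unfolding r_def using real_vector.sum_representation_eq[OF F(3) _ finF] spanF by simp
    define v where "v = (\<Sum>d\<in>F. p (r d) *\<^sub>R d)"
    have lin: "linear (\<lambda>x. B x Z)" for Z
      using bilinear_B by (simp add: bilinear_def)
    have eqE: "B v Z = B (e f g) Z" if Z: "Z \<in> E" for Z
    proof -
      \<comment> \<open>For \<open>d\<close> in \<open>D\<close> the factor \<open>B d Z\<close> is
        a coefficient of \<eta>, so rational; outside \<open>D\<close> the coordinate
        \<open>r d\<close> is zero.\<close>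
      have "p (r d * B d Z) = p (r d) * B d Z" for d
      proof (cases "d \<in> D")
        case True
        then obtain x y where "x \<in> E" "y \<in> E" "d = e x y" using D(1) by (auto simp: S_def)
        then have "B d Z \<in> \<rat>" using rat Z by (simp add: B_e rational_coefficients_def)
        from p(2)[OF this, of "r d"] show ?thesis by (simp add: mult.commute)
      next
        case False
        then show ?thesis using r_D p_rat[of 0] by simp
      qed
      then have "B v Z = p (\<Sum>d\<in>F. r d * B d Z)"
        unfolding v_def p_sum by (simp add: linear_sum[OF lin] B_simps)
      also have "(\<Sum>d\<in>F. r d * B d Z) = B (e f g) Z"
        unfolding efg by (simp add: linear_sum[OF lin] B_simps)
      also have "p \<dots> = B (e f g) Z"
        using rat f g Z by (simp add: B_e rational_coefficients_def p_rat)
      finally show ?thesis .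
    qed
    have "v = e f g"
    proof (rule B_eqI)
      fix Z
      have "linear (B v)" "linear (B (e f g))" using bilinear_B by (simp_all add: bilinear_def)
      from linear_eq_on_span[OF this eqE, of E Z] show "B v Z = B (e f g) Z" using E by simp
    qed
    then have "r h = real_vector.representation F v h" by (simp add: r_def)
    also have "\<dots> = (\<Sum>d\<in>F. p (r d) * real_vector.representation F d h)"
      unfolding v_def using spanF
      by (simp add: real_vector.representation_sum[OF F(3)] real_vector.representation_scale[OF F(3)])
    also have "\<dots> = (\<Sum>d\<in>F. if h = d then p (r d) else 0)"
      by (rule sum.cong) (simp_all add: real_vector.representation_basis[OF F(3)])
    also have "\<dots> \<in> \<rat>"
      using finF p(3) by (simp add: sum.delta)
    finally show ?thesis by (simp add: r_def)
  qed
  then have "real_vector.representation F (e f g) h \<in> \<rat>" if "f \<in> F" "g \<in> F" for f g h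
    using that F(2) e_D by (cases "f \<in> D \<or> g \<in> D") (auto simp: real_vector.representation_zero)
  then show ?thesis
    using that[OF F(3) spanF F(1) e_D(1) e_spanD] by blast
qed

text \<open>Translates the lattice conditions into conditions on a subset of V. Co-compactness holds
  because the quotient is the continuous image of a closed ball.\<close>

lemma lattice_in_L_if_bounded_representatives:
  assumes Lam: "0 \<in> \<Lambda>" "\<And>a b. a \<in> \<Lambda> \<Longrightarrow> b \<in> \<Lambda> \<Longrightarrow> gmul a b \<in> \<Lambda>" "\<And>a. a \<in> \<Lambda> \<Longrightarrow> - a \<in> \<Lambda>"
    and discrete: "\<And>a. a \<in> \<Lambda> \<Longrightarrow> \<exists>U. open U \<and> U \<inter> \<Lambda> = {a}"
    and bounded: "\<And>X. \<exists>a\<in>\<Lambda>. norm (gmul a X) \<le> R"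
  shows "lattice_in_L B \<eta> (gtrans B \<eta> ` \<Lambda>)"
proof -
  let ?\<Gamma> = "gtrans B \<eta> ` \<Lambda>"
  have sub: "subgroup ?\<Gamma> (Lgroup B \<eta>)"
  proof (rule group.subgroupI[OF group_Lgroup])
    show "?\<Gamma> \<noteq> {}" using Lam(1) by blast
    show "inv\<^bsub>Lgroup B \<eta>\<^esub> a \<in> ?\<Gamma>" if "a \<in> ?\<Gamma>" for a
      using that Lam(3) by (auto simp: inv_Lgroup)
    show "a \<otimes>\<^bsub>Lgroup B \<eta>\<^esub> b \<in> ?\<Gamma>" if "a \<in> ?\<Gamma>" "b \<in> ?\<Gamma>" for a b
      using that Lam(2) by (auto simp: gtrans_mult)
  qed (auto simp: carrier_Lgroup)
  have "discrete_topology ?\<Gamma> = subtopology (Ltop B \<eta>) ?\<Gamma>"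
    unfolding discrete_topology_unique
  proof (intro conjI ballI)
    show "topspace (subtopology (Ltop B \<eta>) ?\<Gamma>) = ?\<Gamma>" by (auto simp: topspace_Ltop)
    fix g assume "g \<in> ?\<Gamma>"
    then obtain a where a: "a \<in> \<Lambda>" "g = gtrans B \<eta> a" by blast
    obtain U where U: "open U" "U \<inter> \<Lambda> = {a}" using discrete[OF a(1)] by blast
    have "{g} = gtrans B \<eta> ` U \<inter> ?\<Gamma>"
      unfolding image_Int[OF inj_gtrans, symmetric] U(2) by (simp add: a(2))
    then show "openin (subtopology (Ltop B \<eta>) ?\<Gamma>) {g}"
      unfolding openin_subtopology using openin_Ltop_image[OF U(1)] by blast
  qed
  then have disc: "subtopology (Ltop B \<eta>) ?\<Gamma> = discrete_topology ?\<Gamma>" by simp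
  interpret discrete_subgroup_L B \<eta> ?\<Gamma>
    by (intro discrete_subgroup_L.intro discrete_subgroup_L_axioms.intro
        isotropic_three_form_axioms sub disc)
  have Lam_eq: "local.Lam = \<Lambda>"
    unfolding Lam_def using inj_gtrans by (auto simp: inj_image_mem_iff)
  have "range q = q ` cball 0 R"
  proof (intro equalityI subsetI)
    fix p assume "p \<in> range q"
    then obtain X where X: "p = q X" by blast
    obtain a where "a \<in> \<Lambda>" "norm (gmul a X) \<le> R" using bounded by blast
    then show "p \<in> q ` cball 0 R"
      using q_gmul[of a X] X unfolding Lam_eq by (intro image_eqI[of _ _ "gmul a X"]) auto
  qed auto
  moreover have "compactin (Mtop B \<eta> ?\<Gamma>) (q ` cball 0 R)"
    by (rule image_compactin[OF _ continuous_map_q]) simp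
  ultimately have "compact_space (Mtop B \<eta> ?\<Gamma>)"
    unfolding compact_space_def topspace_Mtop by simp
  then show ?thesis unfolding lattice_in_L_def using sub disc by blast
qed

text \<open>If \<open>N\<close> clears the denominators of the structure constants, the integral
  combinations of the vectors \<open>N f\<close> are closed under \<open>e\<close>, hence under
  \<open>gmul\<close>. Bounded representatives arise by reducing first the coordinates outside
  \<open>D\<close>, then those in \<open>D\<close>.\<close>

theorem rational_form_has_lattice:
  assumes "span E = UNIV" "rational_coefficients \<eta> E"
  shows "\<exists>\<Gamma>. lattice_in_L B \<eta> \<Gamma>"
proof -
  obtain D F where F: "independent F" "span F = UNIV" "D \<subseteq> F"
    and e_D: "\<And>d X. d \<in> D \<Longrightarrow> e d X = 0" and e_spanD: "\<And>X Y. e X Y \<in> span D"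
    and rat: "\<And>f g h. f \<in> F \<Longrightarrow> g \<in> F \<Longrightarrow> real_vector.representation F (e f g) h \<in> \<rat>"
    using rational_adapted_basis[OF assms] by metis
  have finF: "finite F" using F(1) independent_bound by blast
  define x where "x X f = real_vector.representation F X f" for X f
  have x_simps: "x (u + v) f = x u f + x v f" "x (c *\<^sub>R u) f = c * x u f" "x (- u) f = - x u f"
    "x 0 f = 0" for u v c f
    using F by (simp_all add: x_def real_vector.representation_add real_vector.representation_scale real_vector.representation_neg
        real_vector.representation_zero)
  have x_lin: "linear (\<lambda>X. x X f)" for f by (rule linearI) (simp_all add: x_simps)
  have x_expand: "(\<Sum>f\<in>F. x X f *\<^sub>R f) = X" for X
    unfolding x_def using real_vector.sum_representation_eq[OF F(1) _ finF] F(2) by simp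
  have x_basis: "x f h = (if h = f then 1 else 0)" if "f \<in> F" for f h
    unfolding x_def by (simp add: real_vector.representation_basis[OF F(1) that])
  have x_sum: "x (\<Sum>f\<in>G. c f *\<^sub>R f) h = (if h \<in> G then c h else 0)" if "G \<subseteq> F" for G c h
  proof -
    have "x (\<Sum>f\<in>G. c f *\<^sub>R f) h = (\<Sum>f\<in>G. c f * x f h)"
      by (simp add: linear_sum[OF x_lin] x_simps)
    also have "\<dots> = (\<Sum>f\<in>G. if h = f then c f else 0)"
      using that by (intro sum.cong) (auto simp: x_basis)
    finally show ?thesis using finite_subset[OF that finF] by simp
  qed
  have x_e: "x (e X Y) f = 0" if "f \<notin> D" for X Y f
    unfolding x_def using real_vector.representation_extend[OF F(1) e_spanD F(3)] that real_vector.representation_ne_zero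
    by metis
  have "finite ((\<lambda>(f, g, h). x (e f g) h) ` (F \<times> F \<times> F))" using finF by simp
  moreover have "(\<lambda>(f, g, h). x (e f g) h) ` (F \<times> F \<times> F) \<subseteq> \<rat>"
    using rat by (auto simp: x_def)
  ultimately obtain N :: nat where N: "N > 0"
    and Nint: "\<And>f g h. f \<in> F \<Longrightarrow> g \<in> F \<Longrightarrow> h \<in> F \<Longrightarrow> real N * x (e f g) h \<in> \<int>"
    using common_denominator by (smt (verit) SigmaI case_prod_conv image_eqI)
  define \<Lambda> where "\<Lambda> = {X. \<forall>f\<in>F. x X f / N \<in> \<int>}"
  have e_\<Lambda>: "x (e a b) h / N \<in> \<int>" if a: "a \<in> \<Lambda>" and b: "b \<in> \<Lambda>" and h: "h \<in> F" for a b h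
  proof -
    have "e a b = (\<Sum>f\<in>F. \<Sum>g\<in>F. (x a f * x b g) *\<^sub>R e f g)"
    proof -
      have "e a b = e (\<Sum>f\<in>F. x a f *\<^sub>R f) (\<Sum>g\<in>F. x b g *\<^sub>R g)" by (simp add: x_expand)
      also have "\<dots> = (\<Sum>f\<in>F. \<Sum>g\<in>F. e (x a f *\<^sub>R f) (x b g *\<^sub>R g))"
        by (simp add: bilinear_sum[OF bilinear_e] sum.cartesian_product)
      finally show ?thesis by (simp add: e_simps mult.commute)
    qed
    \<comment> \<open>One of the two factors \<open>N\<close> in \<open>a\<close> and
      \<open>b\<close> clears the denominator, the other keeps the result divisible by
      \<open>N\<close>.\<close>
    then have "x (e a b) h / N = (\<Sum>f\<in>F. \<Sum>g\<in>F. (x a f / N) * (x b g / N) * (N * x (e f g) h))"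
      using N by (simp add: linear_sum[OF x_lin] x_simps sum_divide_distrib mult.assoc)
    also have "\<dots> \<in> \<int>"
      using a b Nint[OF _ _ h] by (intro Ints_sum Ints_mult[OF Ints_mult]) (auto simp: \<Lambda>_def)
    finally show ?thesis .
  qed
  define R where "R = (\<Sum>f\<in>F. real N * norm f)"
  have "lattice_in_L B \<eta> (gtrans B \<eta> ` \<Lambda>)"
  proof (rule lattice_in_L_if_bounded_representatives)
    show "0 \<in> \<Lambda>" by (simp add: \<Lambda>_def x_simps)
    show "- a \<in> \<Lambda>" if "a \<in> \<Lambda>" for a
      using that by (simp add: \<Lambda>_def x_simps)
    show gmul_\<Lambda>: "gmul a b \<in> \<Lambda>" if "a \<in> \<Lambda>" "b \<in> \<Lambda>" for a b
    proof -
      have "x (gmul a b) f / N = x a f / N + x b f / N + x (e a b) f / N" for f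
        by (simp add: gmul_def x_simps add_divide_distrib)
      then show ?thesis
        using that e_\<Lambda>[OF that] by (simp add: \<Lambda>_def)
    qed
    show "\<exists>U. open U \<and> U \<inter> \<Lambda> = {a}" if a: "a \<in> \<Lambda>" for a
    proof -
      \<comment> \<open>Coordinates of points of \<open>\<Lambda>\<close> are multiples of
        \<open>N\<close>, so an open box of half-width \<open>N\<close> isolates
        \<open>a\<close>.\<close>
      define U where "U = (\<Inter>f\<in>F. (\<lambda>X. x X f) -` {x a f - N <..< x a f + N})"
      have "open ((\<lambda>X. x X f) -` {x a f - N <..< x a f + N})" for f
        using x_lin[of f] by (intro open_vimage) (auto intro!: linear_continuous_on simp: linear_conv_bounded_linear)
      then have "open U" unfolding U_def using finF by (intro open_INT) auto
      have "b = a" if b: "b \<in> U \<inter> \<Lambda>" for b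
      proof -
        have "x b f = x a f" if f: "f \<in> F" for f
        proof -
          have "\<bar>x b f - x a f\<bar> < N" using b f by (auto simp: U_def)
          then have "\<bar>x b f / N - x a f / N\<bar> < 1"
            using N by (simp add: diff_divide_distrib[symmetric] abs_divide)
          moreover have "x b f / N - x a f / N \<in> \<int>" using a b f by (auto simp: \<Lambda>_def)
          ultimately have "x b f / N - x a f / N = 0" using Ints_nonzero_abs_less1 by blast
          then show ?thesis using N by simp
        qed
        then have "(\<Sum>f\<in>F. x b f *\<^sub>R f) = (\<Sum>f\<in>F. x a f *\<^sub>R f)" by (intro sum.cong) auto
        then show ?thesis by (simp add: x_expand)
      qed
      moreover have "a \<in> U" using N by (auto simp: U_def)
      ultimately have "U \<inter> \<Lambda> = {a}" using a by blast
      then show ?thesis using \<open>open U\<close> by blast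
    qed
    fix X
    \<comment> \<open>Adding \<open>red G Y\<close> brings the coordinates of \<open>Y\<close> with
      index in \<open>G\<close> into an interval of length \<open>N\<close>.\<close>
    define red where "red G Y = - (\<Sum>f\<in>G. (real N * of_int \<lfloor>x Y f / N\<rfloor>) *\<^sub>R f)" for G Y
    have x_red: "x (red G Y) f = (if f \<in> G then - (real N * of_int \<lfloor>x Y f / N\<rfloor>) else 0)" if "G \<subseteq> F" for G Y f
      unfolding red_def by (simp add: x_simps x_sum[OF that])
    have red_\<Lambda>: "red G Y \<in> \<Lambda>" if "G \<subseteq> F" for G Y
      using N by (auto simp: \<Lambda>_def x_red[OF that])
    \<comment> \<open>The order matters: the first translation disturbs coordinates in
      \<open>D\<close> through \<open>e\<close>. The second uses an element of the span of
      \<open>D\<close>, so it is a pure translation and leaves the other coordinates alone.\<close>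
    define Y where "Y = gmul (red (F - D) X) X"
    define Z where "Z = gmul (red D Y) Y"
    have "e (red D Y) Y = 0"
    proof -
      have lin: "linear (\<lambda>u. e u Y)" using bilinear_e by (simp add: bilinear_def)
      show ?thesis
        unfolding red_def by (simp add: e_simps linear_sum[OF lin] e_D)
    qed
    then have Z: "Z = red D Y + Y" by (simp add: Z_def gmul_def)
    have frac: "0 \<le> t - real N * of_int \<lfloor>t / N\<rfloor> \<and> t - real N * of_int \<lfloor>t / N\<rfloor> \<le> N" for t :: real
    proof -
      define k :: real where "k = of_int \<lfloor>t / real N\<rfloor>"
      have "k \<le> t / real N" "t / real N \<le> k + 1" unfolding k_def by linarith+
      then show ?thesis using N unfolding k_def[symmetric] by (simp add: field_simps)
    qed
    have bound: "\<bar>x Z f\<bar> \<le> N" if "f \<in> F" for f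
    proof (cases "f \<in> D")
      case True
      then have "x Z f = x Y f - real N * of_int \<lfloor>x Y f / N\<rfloor>"
        by (simp add: Z x_simps x_red[OF F(3)])
      then show ?thesis using frac[of "x Y f"] by simp
    next
      case False
      then have "x Z f = x Y f" by (simp add: Z x_simps x_red[OF F(3)])
      also have "\<dots> = x X f - real N * of_int \<lfloor>x X f / N\<rfloor>"
        using False that by (simp add: Y_def gmul_def x_simps x_red x_e)
      finally show ?thesis using frac[of "x X f"] by simp
    qed
    have "norm Z \<le> (\<Sum>f\<in>F. norm (x Z f *\<^sub>R f))"
      using norm_sum[of "\<lambda>f. x Z f *\<^sub>R f" F] by (simp only: x_expand)
    also have "\<dots> \<le> R"
      unfolding R_def using bound by (intro sum_mono) (simp add: mult_right_mono)
    finally have "norm Z \<le> R" .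
    moreover have "Z = gmul (gmul (red D Y) (red (F - D) X)) X"
      by (simp add: Z_def Y_def gmul_assoc)
    ultimately show "\<exists>a\<in>\<Lambda>. norm (gmul a X) \<le> R"
      using gmul_\<Lambda> red_\<Lambda>[OF F(3)] red_\<Lambda>[of "F - D"] by (metis Diff_subset)
  qed
  then show ?thesis by blast
qed

end

theorem mainTheorem17:
  fixes B :: "'v::euclidean_space \<Rightarrow> 'v \<Rightarrow> real"
    and \<eta> :: "'v \<Rightarrow> 'v \<Rightarrow> 'v \<Rightarrow> real"
    and J :: "'v \<Rightarrow> 'v"
    and \<epsilon> :: real
  assumes "scalar_product B"
    and "even DIM('v)"
    and "\<epsilon> \<in> {-1, 1}"
    and "so_pred B J"
    and "\<And>v. J (J v) = \<epsilon> *\<^sub>R v"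
    and "alternating3 \<eta>"
    and "\<exists>x y z. \<eta> x y z \<noteq> 0"
    and "totally_isotropic B (supp3 B \<eta>)"
    and "\<And>X Y. contr B \<eta> X (J Y) + J (contr B \<eta> X Y) = 0"
    and "\<exists>E. independent E \<and> span E = UNIV \<and> rational_coefficients \<eta> E"
  shows "(\<exists>\<Gamma>. lattice_in_L B \<eta> \<Gamma>) \<and>
    (\<forall>\<Gamma>. lattice_in_L B \<eta> \<Gamma> \<longrightarrow>
       compact_space (Mtop B \<eta> \<Gamma>) \<and>
       (\<exists>hM JM. induced_structure B \<eta> J \<Gamma> hM JM \<and>
          nearly_kaehler \<epsilon> (Mtop B \<eta> \<Gamma>) (Matlas B \<eta> \<Gamma>) hM JM \<and>
          \<not> admits_transitive_automorphism_group (Mtop B \<eta> \<Gamma>) (Matlas B \<eta> \<Gamma>) hM JM))"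
proof -
  interpret isotropic_three_form B \<eta>
    using assms(1,6,8) by (rule isotropic_three_form.intro)
  \<comment> \<open>The geometric claims are shown for an arbitrary lattice, not just for the
    constructed one.\<close>
  have "compact_space (Mtop B \<eta> \<Gamma>) \<and>
       (\<exists>hM JM. induced_structure B \<eta> J \<Gamma> hM JM \<and>
          nearly_kaehler \<epsilon> (Mtop B \<eta> \<Gamma>) (Matlas B \<eta> \<Gamma>) hM JM \<and>
          \<not> admits_transitive_automorphism_group (Mtop B \<eta> \<Gamma>) (Matlas B \<eta> \<Gamma>) hM JM)"
    if \<Gamma>: "lattice_in_L B \<eta> \<Gamma>" for \<Gamma>
  proof -
    have compact: "compact_space (Mtop B \<eta> \<Gamma>)"
      and "discrete_subgroup_L B \<eta> \<Gamma>"
      using \<Gamma> isotropic_three_form_axioms unfolding lattice_in_L_def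
      by (auto intro!: discrete_subgroup_L.intro discrete_subgroup_L_axioms.intro)
    moreover have "nearly_kaehler_quotient_axioms B \<eta> J \<epsilon>"
      using assms(3,4,5,9) by (intro nearly_kaehler_quotient_axioms.intro) auto
    ultimately interpret nearly_kaehler_quotient B \<eta> \<Gamma> J \<epsilon>
      by (intro nearly_kaehler_quotient.intro)
    obtain x y z where "\<eta> x y z \<noteq> 0" using assms(7) by blast
    then show ?thesis
      using compact induced nearly_kaehler_M inhomogeneous by blast
  qed
  then show ?thesis
    using assms(10) rational_form_has_lattice by blast
qed

end
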